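(* For the truncated CMC hierarchy, let $\mathbf V_\pm$ be the dressed additional Killing fields, let $\mathfrak t=\frac{1}{2\mathrm i}\sum_{m=0}^{N}\lambda^{-(2m+2)}t_m$, and let $$\begin{pmatrix}\mathbf P_+\\ \mathbf P_-\end{pmatrix}:=\begin{pmatrix}\cosh(4\sqrt\gamma\lambda\mathfrak t)& -\sinh(4\sqrt\gamma\lambda\mathfrak t)\lambda^{-1}\\ -\sinh(4\sqrt\gamma\lambda\mathfrak t)\lambda&\cosh(4\sqrt\gamma\lambda\mathfrak t)\end{pmatrix}\begin{pmatrix}\mathbf V_+\\ \mathbf V_-\end{pmatrix}.$$ Then $\mathbf P_\pm$ satisfy (formally) the Killing field equation for $\phi$, $$d\mathbf P_\pm+[\phi,\mathbf P_\pm]=0 .$$ The set of three Killing fields $\{\mathbf Y,\mathbf P_+,\mathbf P_-\}$ generates the space of (formal) Killing fields for $\phi$ which are of the form $$\mathbf Q_0+\cosh(4\sqrt\gamma\lambda\mathfrak t)\,\mathbf Q_+ +\sinh(4\sqrt\gamma\lambda\mathfrak t)\,\lambda\,\mathbf Q_-,$$ where $\mathbf Q_0,\mathbf Q_\pm$ are $\boldsymbol{\mathfrak g}_{\ge0}$-valued.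
   Context: Conventions. $N\ge 0$ is a fixed integer; $\gamma$ is a fixed nonzero constant with $\bar\gamma=\gamma$ and a fixed root $\sqrt\gamma$; $\mathrm i=\sqrt{-1}$; $\lambda$ is a formal parameter. The bar is complex conjugation extended by $\bar\lambda=\lambda^{-1}$, and $\bar A^t$ is the conjugate transpose. For a matrix 1-form $\phi$ and matrix function $A$, $[\phi,A]=\phi A-A\phi$. $\boldsymbol{\mathfrak g}$ is the twisted loop algebra of formal Laurent series (finitely many negative powers) in $\mathfrak{sl}(2,\mathbb C)((\lambda))$ whose diagonal entries are even and whose off-diagonal entries are odd in $\lambda$; $\boldsymbol{\mathfrak g}_{\ge k}$, $\boldsymbol{\mathfrak g}_{\le k}$ consist of those containing only powers $\ge k$, $\le k$. Functions with values in such spaces are series whose coefficients are functions on $M$. Truncated CMC hierarchy. A solution consists of a simply connected manifold $M$ with functions $t_0,\dots,t_N$, their conjugates $\bar t_m$, a real 1-form $\rho$ (with $dt_m,d\bar t_m,\rho$ a coframe), a nowhere zero function $h_2$ with a fixed root $h_2^{1/2}$, and functions $a^{2n+1},b^{2n+2},c^{2n+2}$, $n\ge0$ (superscripts are indices), with $b^2=-\mathrm i\gamma h_2^{-1/2}$, $c^2=\mathrm i h_2^{1/2}$. Put $\mathbf a=\sum_{n\ge0}\lambda^{2n}a^{2n+1}$, $\mathbf b=\sum_{n\ge0}\lambda^{2n+1}b^{2n+2}$, $\mathbf c=\sum_{n\ge0}\lambda^{2n+1}c^{2n+2}$, $$\mathbf Y=\begin{pmatrix}-\mathrm i\mathbf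 a&2\mathbf c\\2\mathbf b&\mathrm i\mathbf a\end{pmatrix},\qquad \det\mathbf Y=\mathbf a^2-4\mathbf b\mathbf c=-4\gamma\lambda^2 .$$ For $m\ge0$ write $\frac1{2\mathrm i}\lambda^{-(2m+2)}\mathbf Y=U_m+U_{(m+1)}$ with $U_m\in\boldsymbol{\mathfrak g}_{\le-1}$, $U_{(m+1)}\in\boldsymbol{\mathfrak g}_{\ge0}$, and put $$\phi=-\sum_{m=0}^N\bar U_m^t\,d\bar t_m+\phi_0+\sum_{m=0}^NU_m\,dt_m,$$ where $\phi_0$ is the diagonal matrix with entries $\frac{\mathrm i}{2}\rho,-\frac{\mathrm i}{2}\rho$. The structure equations are $d\mathbf Y+[\phi,\mathbf Y]=0$ and $d\phi+\phi\wedge\phi=0$, together with their conjugates. A Killing field for $\phi$ is a matrix function $\mathbf P$ with $d\mathbf P+[\phi,\mathbf P]=0$. Dressed objects. $\alpha=\frac1{2\mathrm i}\sum_{m=0}^N\lambda^{-(2m+2)}dt_m=d\mathfrak t$ and $\check\phi=\phi-\mathbf Y\alpha$ (with entries $\check\phi^i_j$); $\check\phi$ is $\boldsymbol{\mathfrak g}_{\ge0}$-valued. Fix a root $\sqrt{\mathbf b\mathbf c}$ (note $\mathbf b\mathbf c=\gamma\lambda^2+\cdots$), put $\kappa=\frac{1}{2\sqrt{\mathbf b\mathbf c}}$, and let $\mathbf p$ be a $\mathbb C[[\lambda^2]]$-valued function with $d\mathbf p=\sqrt\gamma\,(\mathbf b\check\phi^1_2+\mathbf c\check\phi^2_1)/(\mathbf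 b\mathbf c)$ (a closed 1-form). Set $$\mathbf V_+=\kappa\begin{pmatrix}2\sinh(\lambda\mathbf p)\lambda^{-1}\mathbf b\mathbf c&2\sqrt\gamma\cosh(\lambda\mathbf p)\mathbf c+\mathrm i\sinh(\lambda\mathbf p)\lambda^{-1}\mathbf a\mathbf c\\-2\sqrt\gamma\cosh(\lambda\mathbf p)\mathbf b+\mathrm i\sinh(\lambda\mathbf p)\lambda^{-1}\mathbf a\mathbf b&-2\sinh(\lambda\mathbf p)\lambda^{-1}\mathbf b\mathbf c\end{pmatrix},$$ $$\mathbf V_-=\kappa\begin{pmatrix}-2\cosh(\lambda\mathbf p)\mathbf b\mathbf c&-2\sqrt\gamma\sinh(\lambda\mathbf p)\lambda\mathbf c-\mathrm i\cosh(\lambda\mathbf p)\mathbf a\mathbf c\\2\sqrt\gamma\sinh(\lambda\mathbf p)\lambda\mathbf b-\mathrm i\cosh(\lambda\mathbf p)\mathbf a\mathbf b&2\cosh(\lambda\mathbf p)\mathbf b\mathbf c\end{pmatrix}.$$ "Formal" refers to the fact that $\mathfrak t$ contains negative powers of $\lambda$, so that $\cosh(4\sqrt\gamma\lambda\mathfrak t)$ and $\sinh(4\sqrt\gamma\lambda\mathfrak t)$ are treated as formal expressions obeying the usual algebraic and differentiation rules. *)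

theory Defs
  imports
    "HOL-Analysis.Analysis"
    "HOL-Computational_Algebra.Formal_Laurent_Series"
    "HOL-Library.Function_Algebras"
    "HOL-Library.Poly_Mapping"
begin

text \<open>
  Conventions. The manifold \<open>M\<close> is the whole type \<open>'m\<close> (Hausdorff, second countable), made smooth by
  an atlas with values in a Euclidean space \<open>'e\<close>. Functions on \<open>M\<close> carry the pointwise ring
  structure of \<^theory>\<open>HOL-Library.Function_Algebras\<close>. A Laurent series in the formal parameter
  \<open>\<lambda>\<close> whose coefficients are functions on \<open>M\<close> is an element of \<open>('m \<Rightarrow> complex) fls\<close>, with
  \<open>\<lambda>\<close> being \<open>fls_X\<close>.
\<close>

section \<open>Smooth manifolds, vector fields and forms\<close>

text \<open>\<open>k\<close> times continuously differentiable, and smooth, on an open set.\<close>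

fun Ck_on :: "nat \<Rightarrow> 'e::euclidean_space set \<Rightarrow> ('e \<Rightarrow> 'f::real_normed_vector) \<Rightarrow> bool" where
  "Ck_on 0 S f \<longleftrightarrow> continuous_on S f"
| "Ck_on (Suc k) S f \<longleftrightarrow>
     f differentiable_on S \<and> (\<forall>v. Ck_on k S (\<lambda>x. frechet_derivative f (at x) v))"

definition smooth_on :: "'e::euclidean_space set \<Rightarrow> ('e \<Rightarrow> 'f::real_normed_vector) \<Rightarrow> bool" where
  "smooth_on S f \<longleftrightarrow> (\<forall>k. Ck_on k S f)"

type_synonym ('m, 'e) chart = "'m set \<times> ('m \<Rightarrow> 'e)"

definition smooth_atlas :: "('m::{t2_space,second_countable_topology}, 'e::euclidean_space) chart set \<Rightarrow> bool"
  where
  "smooth_atlas \<A> \<longleftrightarrow>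
     (\<Union>(U, \<psi>)\<in>\<A>. U) = UNIV \<and>
     (\<forall>(U, \<psi>)\<in>\<A>. open U \<and> open (\<psi> ` U) \<and> homeomorphism U (\<psi> ` U) \<psi> (inv_into U \<psi>)) \<and>
     (\<forall>(U, \<psi>)\<in>\<A>. \<forall>(V, \<psi>')\<in>\<A>. smooth_on (\<psi> ` (U \<inter> V)) (\<psi>' \<circ> inv_into U \<psi>))"

definition smooth_fun ::
  "('m::{t2_space,second_countable_topology}, 'e::euclidean_space) chart set \<Rightarrow> ('m \<Rightarrow> complex) \<Rightarrow> bool"
  where
  "smooth_fun \<A> f \<longleftrightarrow> (\<forall>(U, \<psi>)\<in>\<A>. smooth_on (\<psi> ` U) (f \<circ> inv_into U \<psi>))"

text \<open>
  The real tangent space at \<open>x\<close>: derivations at \<open>x\<close> of the algebra of complex valued smooth functions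
  that commute with complex conjugation, i.e. the complex linear extensions of the derivations of the
  real smooth functions. The last clause only makes the representing map unique.
\<close>

type_synonym 'm tvec = "('m \<Rightarrow> complex) \<Rightarrow> complex"

definition tangent_space ::
  "('m::{t2_space,second_countable_topology}, 'e::euclidean_space) chart set \<Rightarrow> 'm \<Rightarrow> 'm tvec set"
  where
  "tangent_space \<A> x = {v.
     (\<forall>f g. smooth_fun \<A> f \<longrightarrow> smooth_fun \<A> g \<longrightarrow>
        v (f + g) = v f + v g \<and> v (f * g) = f x * v g + v f * g x) \<and>
     (\<forall>c f. smooth_fun \<A> f \<longrightarrow> v (\<lambda>y. c * f y) = c * v f) \<and>
     (\<forall>f. smooth_fun \<A> f \<longrightarrow> v (\<lambda>y. cnj (f y)) = cnj (v f)) \<and>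
     (\<forall>f. \<not> smooth_fun \<A> f \<longrightarrow> v f = 0)}"

text \<open>Complex valued covectors: real linear maps from the tangent space to the complex numbers.\<close>

definition cotangent_space ::
  "('m::{t2_space,second_countable_topology}, 'e::euclidean_space) chart set \<Rightarrow> 'm
     \<Rightarrow> ('m tvec \<Rightarrow> complex) set"
  where
  "cotangent_space \<A> x = {\<xi>.
     (\<forall>v\<in>tangent_space \<A> x. \<forall>w\<in>tangent_space \<A> x. \<xi> (v + w) = \<xi> v + \<xi> w) \<and>
     (\<forall>s::real. \<forall>v\<in>tangent_space \<A> x. \<xi> (\<lambda>f. of_real s * v f) = of_real s * \<xi> v)}"

text \<open>
  \<open>vfield\<close>: arbitrary (not necessarily continuous) sections of the tangent bundle. An identity between
  1-forms is a pointwise identity, so it may be tested on all of them; smoothness of the section matters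
  only where it is differentiated.
\<close>

type_synonym 'm vfield = "'m \<Rightarrow> 'm tvec"

definition vfield ::
  "('m::{t2_space,second_countable_topology}, 'e::euclidean_space) chart set \<Rightarrow> 'm vfield \<Rightarrow> bool" where
  "vfield \<A> X \<longleftrightarrow> (\<forall>x. X x \<in> tangent_space \<A> x)"

definition smooth_vfield ::
  "('m::{t2_space,second_countable_topology}, 'e::euclidean_space) chart set \<Rightarrow> 'm vfield \<Rightarrow> bool" where
  "smooth_vfield \<A> X \<longleftrightarrow> vfield \<A> X \<and> (\<forall>f. smooth_fun \<A> f \<longrightarrow> smooth_fun \<A> (\<lambda>x. X x f))"

definition vfield_bracket ::
  "('m::{t2_space,second_countable_topology}, 'e::euclidean_space) chart set
     \<Rightarrow> 'm vfield \<Rightarrow> 'm vfield \<Rightarrow> 'm vfield"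
  where
  "vfield_bracket \<A> X Y =
     (\<lambda>x f. if smooth_fun \<A> f then X x (\<lambda>y. Y y f) - Y x (\<lambda>y. X y f) else 0)"

definition real_one_form ::
  "('m::{t2_space,second_countable_topology}, 'e::euclidean_space) chart set
     \<Rightarrow> ('m \<Rightarrow> 'm tvec \<Rightarrow> real) \<Rightarrow> bool"
  where
  "real_one_form \<A> \<rho> \<longleftrightarrow>
     (\<forall>x. (\<lambda>v. complex_of_real (\<rho> x v)) \<in> cotangent_space \<A> x) \<and>
     (\<forall>X. smooth_vfield \<A> X \<longrightarrow> smooth_fun \<A> (\<lambda>x. complex_of_real (\<rho> x (X x))))"

section \<open>Laurent series and the twisted loop algebra\<close>

type_synonym 'm lser = "('m \<Rightarrow> complex) fls"
type_synonym 'm lmat = "'m lser ^ 2 ^ 2"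

abbreviation cst :: "complex \<Rightarrow> 'm lser" where
  "cst z \<equiv> fls_const (\<lambda>_. z)"

abbreviation lam :: "int \<Rightarrow> 'm lser" where
  "lam k \<equiv> fls_X_intpow k"

definition mat2 :: "'a::zero \<Rightarrow> 'a \<Rightarrow> 'a \<Rightarrow> 'a \<Rightarrow> 'a ^ 2 ^ 2" where
  "mat2 p q r s = vector [vector [p, q], vector [r, s]]"

definition scale_mat :: "'a::times \<Rightarrow> 'a ^ 2 ^ 2 \<Rightarrow> 'a ^ 2 ^ 2" where
  "scale_mat k A = map_matrix (\<lambda>u. k * u) A"

definition commut :: "'a::ring_1 ^ 2 ^ 2 \<Rightarrow> 'a ^ 2 ^ 2 \<Rightarrow> 'a ^ 2 ^ 2" where
  "commut A B = A ** B - B ** A"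

text \<open>Value on the section \<open>X\<close> of the differential of a series, taken coefficientwise.\<close>

definition d_ser :: "'m vfield \<Rightarrow> 'm lser \<Rightarrow> 'm lser" where
  "d_ser X s = Abs_fls (\<lambda>n x. X x (fls_nth s n))"

definition smooth_ser ::
  "('m::{t2_space,second_countable_topology}, 'e::euclidean_space) chart set \<Rightarrow> 'm lser \<Rightarrow> bool" where
  "smooth_ser \<A> s \<longleftrightarrow> (\<forall>n. smooth_fun \<A> (fls_nth s n))"

text \<open>
  Complex conjugation with \<open>\<lambda>\<close> sent to its inverse. Meaningful (and only used) for Laurent polynomials
  in \<open>\<lambda>\<close>, since the image of an infinite series has infinitely many negative powers.
\<close>

definition bar_ser :: "'m lser \<Rightarrow> 'm lser" where
  "bar_ser s = Abs_fls (\<lambda>n x. cnj (fls_nth s (- n) x))"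

definition bar_transpose :: "'m lmat \<Rightarrow> 'm lmat" where
  "bar_transpose A = map_matrix bar_ser (transpose A)"

definition negative_part :: "'m lser \<Rightarrow> 'm lser" where
  "negative_part s = s - fps_to_fls (fls_regpart s)"

text \<open>Functions with values in the twisted loop algebra, and in its subspace of powers \<open>\<ge> k\<close>.\<close>

definition loop_algebra ::
  "('m::{t2_space,second_countable_topology}, 'e::euclidean_space) chart set \<Rightarrow> 'm lmat set" where
  "loop_algebra \<A> = {Q.
     (\<forall>i j. smooth_ser \<A> (Q $ i $ j)) \<and>
     trace Q = 0 \<and>
     (\<forall>i j n. (if i = j then odd n else even n) \<longrightarrow> fls_nth (Q $ i $ j) n = 0)}"

definition loop_algebra_ge ::
  "('m::{t2_space,second_countable_topology}, 'e::euclidean_space) chart set \<Rightarrow> int \<Rightarrow> 'm lmat set" where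
  "loop_algebra_ge \<A> k = {Q \<in> loop_algebra \<A>. \<forall>i j. \<forall>n<k. fls_nth (Q $ i $ j) n = 0}"

section \<open>The truncated CMC hierarchy\<close>

text \<open>
  \<open>acoef n\<close>, \<open>bcoef n\<close>, \<open>ccoef n\<close> are the functions \<open>a\<^sup>2\<^sup>n\<^sup>+\<^sup>1\<close>, \<open>b\<^sup>2\<^sup>n\<^sup>+\<^sup>2\<close>, \<open>c\<^sup>2\<^sup>n\<^sup>+\<^sup>2\<close>. Only the functions
  \<open>tim m\<close> with \<open>m \<le> level\<close> are used. \<open>sgam\<close> and \<open>sh2\<close> are the fixed roots of \<open>gam\<close> and \<open>h2\<close>.
\<close>

record ('m, 'e) cmc =
  atlas :: "('m, 'e) chart set"
  level :: nat
  gam :: complex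
  sgam :: complex
  tim :: "nat \<Rightarrow> 'm \<Rightarrow> complex"
  rho :: "'m \<Rightarrow> 'm tvec \<Rightarrow> real"
  h2 :: "'m \<Rightarrow> complex"
  sh2 :: "'m \<Rightarrow> complex"
  acoef :: "nat \<Rightarrow> 'm \<Rightarrow> complex"
  bcoef :: "nat \<Rightarrow> 'm \<Rightarrow> complex"
  ccoef :: "nat \<Rightarrow> 'm \<Rightarrow> complex"

definition a_ser :: "('m, 'e) cmc \<Rightarrow> 'm lser" where
  "a_ser H = fps_to_fls (Abs_fps (\<lambda>k. if even k then acoef H (k div 2) else 0))"

definition b_ser :: "('m, 'e) cmc \<Rightarrow> 'm lser" where
  "b_ser H = fps_to_fls (Abs_fps (\<lambda>k. if odd k then bcoef H (k div 2) else 0))"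

definition c_ser :: "('m, 'e) cmc \<Rightarrow> 'm lser" where
  "c_ser H = fps_to_fls (Abs_fps (\<lambda>k. if odd k then ccoef H (k div 2) else 0))"

definition Y_mat :: "('m, 'e) cmc \<Rightarrow> 'm lmat" where
  "Y_mat H = mat2 (cst (- \<i>) * a_ser H) (2 * c_ser H)
                  (2 * b_ser H)          (cst \<i> * a_ser H)"

definition U_mat :: "('m, 'e) cmc \<Rightarrow> nat \<Rightarrow> 'm lmat" where
  "U_mat H m = map_matrix negative_part
     (scale_mat (cst (1 / (2 * \<i>)) * lam (- (2 * int m + 2))) (Y_mat H))"

text \<open>Matrix valued 1-forms are given by their values on sections of the tangent bundle.\<close>

definition d_fun :: "'m vfield \<Rightarrow> ('m \<Rightarrow> complex) \<Rightarrow> 'm \<Rightarrow> complex" where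
  "d_fun X f = (\<lambda>x. X x f)"

definition phi :: "('m, 'e) cmc \<Rightarrow> 'm vfield \<Rightarrow> 'm lmat" where
  "phi H X =
     - (\<Sum>m\<le>level H. scale_mat (fls_const (d_fun X (\<lambda>x. cnj (tim H m x)))) (bar_transpose (U_mat H m)))
     + mat2 (fls_const (\<lambda>x. \<i> / 2 * of_real (rho H x (X x)))) 0
            0 (fls_const (\<lambda>x. - (\<i> / 2) * of_real (rho H x (X x))))
     + (\<Sum>m\<le>level H. scale_mat (fls_const (d_fun X (tim H m))) (U_mat H m))"

text \<open>The 1-forms \<open>dt\<^sub>m\<close>, their conjugates and \<open>\<rho>\<close> form, at each point, a complex basis of the
  complex valued covectors.\<close>

definition coframe ::
  "('m::{t2_space,second_countable_topology}, 'e::euclidean_space) cmc \<Rightarrow> bool" where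
  "coframe H \<longleftrightarrow> (\<forall>x.
     (\<forall>u w. \<forall>s::complex.
        (\<forall>v\<in>tangent_space (atlas H) x.
           (\<Sum>m\<le>level H. u m * v (tim H m)) + (\<Sum>m\<le>level H. w m * v (\<lambda>y. cnj (tim H m y)))
             + s * of_real (rho H x v) = 0)
        \<longrightarrow> (\<forall>m\<le>level H. u m = 0 \<and> w m = 0) \<and> s = 0) \<and>
     (\<forall>\<xi>\<in>cotangent_space (atlas H) x. \<exists>u w. \<exists>s::complex.
        \<forall>v\<in>tangent_space (atlas H) x.
          \<xi> v = (\<Sum>m\<le>level H. u m * v (tim H m)) + (\<Sum>m\<le>level H. w m * v (\<lambda>y. cnj (tim H m y)))
                 + s * of_real (rho H x v)))"

text \<open>
  Solutions of the hierarchy. The value of \<open>d\<phi> + \<phi> \<and> \<phi>\<close> on a pair \<open>X, X'\<close> uses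
  \<open>d\<omega>(X,X') = X(\<omega>(X')) - X'(\<omega>(X)) - \<omega>([X,X'])\<close> and
  \<open>(\<omega> \<and> \<eta>)(X,X') = \<omega>(X) \<eta>(X') - \<omega>(X') \<eta>(X)\<close>. The conjugates of the structure equations are
  not listed: all coefficients are honest functions and tangent vectors are real, so they are the images
  of the listed equations under conjugation.
\<close>

definition truncated_cmc_hierarchy ::
  "('m::{t2_space,second_countable_topology}, 'e::euclidean_space) cmc \<Rightarrow> bool" where
  "truncated_cmc_hierarchy H \<longleftrightarrow>
     smooth_atlas (atlas H) \<and> simply_connected (UNIV :: 'm set) \<and>
     gam H \<noteq> 0 \<and> cnj (gam H) = gam H \<and> (sgam H)\<^sup>2 = gam H \<and>
     (\<forall>m\<le>level H. smooth_fun (atlas H) (tim H m)) \<and>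
     real_one_form (atlas H) (rho H) \<and>
     coframe H \<and>
     smooth_fun (atlas H) (h2 H) \<and> (\<forall>x. h2 H x \<noteq> 0) \<and>
     smooth_fun (atlas H) (sh2 H) \<and> (\<forall>x. (sh2 H x)\<^sup>2 = h2 H x) \<and>
     (\<forall>n. smooth_fun (atlas H) (acoef H n) \<and> smooth_fun (atlas H) (bcoef H n) \<and>
          smooth_fun (atlas H) (ccoef H n)) \<and>
     (\<forall>x. bcoef H 0 x = - \<i> * gam H / sh2 H x \<and> ccoef H 0 x = \<i> * sh2 H x) \<and>
     det (Y_mat H) = cst (- 4 * gam H) * lam 2 \<and>
     (\<forall>X. vfield (atlas H) X \<longrightarrow>
        map_matrix (d_ser X) (Y_mat H) + commut (phi H X) (Y_mat H) = 0) \<and>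
     (\<forall>X X'. smooth_vfield (atlas H) X \<longrightarrow> smooth_vfield (atlas H) X' \<longrightarrow>
        map_matrix (d_ser X) (phi H X') - map_matrix (d_ser X') (phi H X)
          - phi H (vfield_bracket (atlas H) X X')
          + (phi H X ** phi H X' - phi H X' ** phi H X) = 0)"

section \<open>Dressed objects\<close>

definition t_frak :: "('m, 'e) cmc \<Rightarrow> 'm lser" where
  "t_frak H = cst (1 / (2 * \<i>)) * (\<Sum>m\<le>level H. lam (- (2 * int m + 2)) * fls_const (tim H m))"

definition alpha :: "('m, 'e) cmc \<Rightarrow> 'm vfield \<Rightarrow> 'm lser" where
  "alpha H X = cst (1 / (2 * \<i>)) *
     (\<Sum>m\<le>level H. lam (- (2 * int m + 2)) * fls_const (d_fun X (tim H m)))"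

definition phi_check :: "('m, 'e) cmc \<Rightarrow> 'm vfield \<Rightarrow> 'm lmat" where
  "phi_check H X = phi H X - scale_mat (alpha H X) (Y_mat H)"

text \<open>\<open>cosh(\<lambda>p)\<close> and \<open>sinh(\<lambda>p)\<close> as compositions of power series.\<close>

definition cosh_lam :: "('m \<Rightarrow> complex) fps \<Rightarrow> 'm lser" where
  "cosh_lam p = fps_to_fls
     (fps_compose (Abs_fps (\<lambda>n _. if even n then 1 / fact n else 0)) (fps_X * p))"

definition sinh_lam :: "('m \<Rightarrow> complex) fps \<Rightarrow> 'm lser" where
  "sinh_lam p = fps_to_fls
     (fps_compose (Abs_fps (\<lambda>n _. if odd n then 1 / fact n else 0)) (fps_X * p))"

text \<open>
  \<open>r\<close> is the fixed root of \<open>bc\<close>, which is invertible because \<open>bc\<close> has leading term \<open>\<gamma>\<lambda>\<^sup>2\<close>;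
  \<open>\<kappa> = 1/(2r)\<close> and \<open>p\<close> is the potential with values in even power series, both characterized after
  clearing the (invertible) denominators.
\<close>

definition dressing ::
  "('m::{t2_space,second_countable_topology}, 'e::euclidean_space) cmc
     \<Rightarrow> 'm lser \<Rightarrow> 'm lser \<Rightarrow> ('m \<Rightarrow> complex) fps \<Rightarrow> bool" where
  "dressing H r \<kappa> p \<longleftrightarrow>
     smooth_ser (atlas H) r \<and> r\<^sup>2 = b_ser H * c_ser H \<and>
     \<kappa> * (2 * r) = 1 \<and>
     (\<forall>n. smooth_fun (atlas H) (fps_nth p n)) \<and> (\<forall>n. odd n \<longrightarrow> fps_nth p n = 0) \<and>
     (\<forall>X. vfield (atlas H) X \<longrightarrow>
        (b_ser H * c_ser H) * d_ser X (fps_to_fls p) =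
        cst (sgam H) * (b_ser H * phi_check H X $ 1 $ 2 + c_ser H * phi_check H X $ 2 $ 1))"

definition V_plus :: "('m, 'e) cmc \<Rightarrow> 'm lser \<Rightarrow> ('m \<Rightarrow> complex) fps \<Rightarrow> 'm lmat" where
  "V_plus H \<kappa> p =
    (let a = a_ser H; b = b_ser H; c = c_ser H; C = cosh_lam p; S = sinh_lam p; g = cst (sgam H)
     in scale_mat \<kappa> (mat2
          (2 * S * lam (-1) * b * c)
          (2 * g * C * c + cst \<i> * S * lam (-1) * a * c)
          (- 2 * g * C * b + cst \<i> * S * lam (-1) * a * b)
          (- 2 * S * lam (-1) * b * c)))"

definition V_minus :: "('m, 'e) cmc \<Rightarrow> 'm lser \<Rightarrow> ('m \<Rightarrow> complex) fps \<Rightarrow> 'm lmat" where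
  "V_minus H \<kappa> p =
    (let a = a_ser H; b = b_ser H; c = c_ser H; C = cosh_lam p; S = sinh_lam p; g = cst (sgam H)
     in scale_mat \<kappa> (mat2
          (- 2 * C * b * c)
          (- 2 * g * S * lam 1 * c - cst \<i> * C * a * c)
          (2 * g * S * lam 1 * b - cst \<i> * C * a * b)
          (2 * C * b * c)))"

section \<open>Formal expressions and formal Killing fields\<close>

text \<open>
  With \<open>K\<close> the ring of Laurent series over functions on \<open>M\<close>, formal expressions are the elements of
  the group ring \<open>K[E, E\<^sup>-\<^sup>1]\<close>, realized as finitely supported functions of the exponent, where
  the free generator \<open>E\<close> stands for the exponential of \<open>4\<surd>\<gamma> \<lambda> \<tt>\<close>. Then
  \<open>cosh = (E + E\<^sup>-\<^sup>1)/2\<close> and \<open>sinh = (E - E\<^sup>-\<^sup>1)/2\<close>; over \<open>K\<close> they are subject to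
  \<open>cosh\<^sup>2 - sinh\<^sup>2 = 1\<close> and its consequences only. The differential extends that of \<open>K\<close> by
  \<open>dE = E d(4\<surd>\<gamma> \<lambda> \<tt>)\<close>.
\<close>

type_synonym 'm fser = "int \<Rightarrow>\<^sub>0 'm lser"
type_synonym 'm fmat = "'m fser ^ 2 ^ 2"

definition emb :: "'m lser \<Rightarrow> 'm fser" where
  "emb k = Poly_Mapping.single 0 k"

definition emb_mat :: "'m lmat \<Rightarrow> 'm fmat" where
  "emb_mat A = map_matrix emb A"

definition cosh_t :: "'m fser" where
  "cosh_t = Poly_Mapping.single 1 (cst (1/2)) + Poly_Mapping.single (-1) (cst (1/2))"

definition sinh_t :: "'m fser" where
  "sinh_t = Poly_Mapping.single 1 (cst (1/2)) - Poly_Mapping.single (-1) (cst (1/2))"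

definition d_formal :: "('m, 'e) cmc \<Rightarrow> 'm vfield \<Rightarrow> 'm fser \<Rightarrow> 'm fser" where
  "d_formal H X F = Poly_Mapping.mapp
     (\<lambda>n k. d_ser X k + of_int n * d_ser X (cst (4 * sgam H) * lam 1 * t_frak H) * k) F"

definition formal_killing ::
  "('m::{t2_space,second_countable_topology}, 'e::euclidean_space) cmc \<Rightarrow> 'm fmat \<Rightarrow> bool" where
  "formal_killing H P \<longleftrightarrow> (\<forall>X. vfield (atlas H) X \<longrightarrow>
     map_matrix (d_formal H X) P + commut (emb_mat (phi H X)) P = 0)"

definition P_plus :: "('m, 'e) cmc \<Rightarrow> 'm lser \<Rightarrow> ('m \<Rightarrow> complex) fps \<Rightarrow> 'm fmat" where
  "P_plus H \<kappa> p =
     scale_mat cosh_t (emb_mat (V_plus H \<kappa> p))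
     + scale_mat (- sinh_t * emb (lam (-1))) (emb_mat (V_minus H \<kappa> p))"

definition P_minus :: "('m, 'e) cmc \<Rightarrow> 'm lser \<Rightarrow> ('m \<Rightarrow> complex) fps \<Rightarrow> 'm fmat" where
  "P_minus H \<kappa> p =
     scale_mat (- sinh_t * emb (lam 1)) (emb_mat (V_plus H \<kappa> p))
     + scale_mat cosh_t (emb_mat (V_minus H \<kappa> p))"

definition cosh_sinh_form ::
  "('m::{t2_space,second_countable_topology}, 'e::euclidean_space) cmc \<Rightarrow> 'm fmat \<Rightarrow> bool" where
  "cosh_sinh_form H Q \<longleftrightarrow>
     (\<exists>Q0\<in>loop_algebra_ge (atlas H) 0. \<exists>Qp\<in>loop_algebra_ge (atlas H) 0. \<exists>Qm\<in>loop_algebra_ge (atlas H) 0.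
        Q = emb_mat Q0 + scale_mat cosh_t (emb_mat Qp) + scale_mat (sinh_t * emb (lam 1)) (emb_mat Qm))"

text \<open>
  The scalars for Killing fields are the Laurent series in \<open>\<lambda>\<close> with coefficients constant on \<open>M\<close>.
  Since \<open>r\<close> is odd in \<open>\<lambda>\<close>, the matrices \<open>V_plus\<close>, \<open>V_minus\<close> have odd diagonal and even off-diagonal
  entries, so it is \<open>\<lambda>\<close> times them that is twisted; scalars of both parities are therefore allowed.
\<close>

definition const_ser :: "complex fls \<Rightarrow> 'm lser" where
  "const_ser u = Abs_fls (\<lambda>n _. fls_nth u n)"

definition killing_comb ::
  "('m, 'e) cmc \<Rightarrow> 'm lser \<Rightarrow> ('m \<Rightarrow> complex) fps \<Rightarrow> complex fls \<Rightarrow> complex fls \<Rightarrow> complex fls \<Rightarrow> 'm fmat"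
  where
  "killing_comb H \<kappa> p u0 up um =
     scale_mat (emb (const_ser u0)) (emb_mat (Y_mat H))
     + scale_mat (emb (const_ser up)) (P_plus H \<kappa> p)
     + scale_mat (emb (const_ser um)) (P_minus H \<kappa> p)"

definition even_power_series :: "complex fls set" where
  "even_power_series = {u. \<forall>n. fls_nth u n \<noteq> 0 \<longrightarrow> 0 \<le> n \<and> even n}"

end

theory Submission
  imports Defs
begin

text \<open>
  For \<open>n = \<plusminus>1\<close> the matrix \<open>W\<^sub>n = V\<^sub>- - n\<lambda>V\<^sub>+\<close> is an eigenvector of \<open>ad Y\<close> with eigenvalue
  \<open>-4n\<surd>\<gamma> \<lambda>\<close>, and it is parallel for the dressed connection. Adding back \<open>\<alpha>Y\<close> turns this into
  \<open>dW\<^sub>n + [\<phi>, W\<^sub>n] + n d\<theta> W\<^sub>n = 0\<close> with \<open>\<theta> = 4\<surd>\<gamma> \<lambda>\<tt>\<close>, that is, \<open>E\<^sup>n W\<^sub>n\<close> is a formal Killing field;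
  \<open>P\<^sub>\<plusminus>\<close> are combinations of \<open>E W\<^sub>1\<close> and \<open>E\<^sup>-\<^sup>1 W\<^sub>-\<^sub>1\<close>.

  Conversely, let \<open>A\<close> be the coefficient of \<open>E\<^sup>n\<close> of a formal Killing field. Its coordinates with respect to
  \<open>Y, W\<^sub>1, W\<^sub>-\<^sub>1\<close> are traces \<open>tr(AB)\<close> up to scalar factors, with \<open>B\<close> in this frame, and such a
  trace \<open>\<tau>\<close> satisfies \<open>d\<tau> + k d\<theta> \<tau> = 0\<close> for an integer \<open>k\<close>. If \<open>k = 0\<close> it is constant on \<open>M\<close>;
  otherwise it vanishes, by looking at the lowest power of \<open>\<lambda>\<close>, since \<open>dt\<^sub>N\<close> vanishes nowhere. So only
  constant multiples of \<open>Y\<close>, \<open>E W\<^sub>1\<close> and \<open>E\<^sup>-\<^sup>1 W\<^sub>-\<^sub>1\<close> remain, and comparing orders and parities in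
  \<open>\<lambda>\<close> of the matrix entries shows which constants occur.
\<close>

(* Overloading the dollar sign makes terms with many matrix entries expensive to parse. *)
no_notation fps_nth (infixl \<open>$\<close> 75)

section \<open>Smooth functions and tangent vectors\<close>

lemma frechet_derivative_cong_open:
  assumes "open S" "x \<in> S" "\<And>y. y \<in> S \<Longrightarrow> f y = g y"
  shows "frechet_derivative f (at x) = frechet_derivative g (at x)"
proof -
  have "(f has_derivative D) (at x) \<longleftrightarrow> (g has_derivative D) (at x)" for D
    using assms by (metis has_derivative_transform_within_open)
  then show ?thesis by (simp add: frechet_derivative_def)
qed

text \<open>Rules for derivatives of sums and products hold only at the points of \<open>S\<close>,
  so the inductions on \<open>k\<close> below have to replace a function by one that agrees with it
  on \<open>S\<close> alone.\<close>

lemma Ck_on_cong: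
  assumes "open S" "\<And>y. y \<in> S \<Longrightarrow> f y = g y"
  shows "Ck_on k S f \<longleftrightarrow> Ck_on k S g"
  using assms(2)
proof (induction k arbitrary: f g)
  case 0
  then show ?case by (simp cong: continuous_on_cong)
next
  case (Suc k)
  have "Ck_on k S (\<lambda>x. frechet_derivative f (at x) v) \<longleftrightarrow>
        Ck_on k S (\<lambda>x. frechet_derivative g (at x) v)" for v
    by (rule Suc.IH) (metis Suc.prems assms(1) frechet_derivative_cong_open)
  moreover have "f differentiable_on S \<longleftrightarrow> g differentiable_on S"
    unfolding differentiable_on_def
    using Suc.prems by (auto intro: differentiable_transform_within[OF _ zero_less_one])
  ultimately show ?case by simp
qed

lemma Ck_on_SucD: "Ck_on (Suc k) S f \<Longrightarrow> Ck_on k S f"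
proof (induction k arbitrary: f)
  case 0
  then show ?case by (simp add: differentiable_imp_continuous_on)
next
  case (Suc k)
  then show ?case by (metis Ck_on.simps(2))
qed

lemma differentiable_on_has_derivative:
  assumes "open S" "f differentiable_on S" "x \<in> S"
  shows "(f has_derivative frechet_derivative f (at x)) (at x)"
  using assms by (simp add: differentiable_on_eq_differentiable_at frechet_derivative_works)

lemma Ck_on_const: "Ck_on k S (\<lambda>x. c)"
  by (induction k arbitrary: c) (auto simp: frechet_derivative_const)

lemma Ck_on_linear:
  assumes "open S" "bounded_linear L" "Ck_on k S f"
  shows "Ck_on k S (\<lambda>x. L (f x))"
  using assms(3)
proof (induction k arbitrary: f)
  case 0
  then show ?case using assms(2) by (simp add: linear_continuous_on_compose linear_linear bounded_linear.continuous_on)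
next
  case (Suc k)
  have d: "((\<lambda>x. L (f x)) has_derivative (\<lambda>v. L (frechet_derivative f (at x) v))) (at x)"
    if "x \<in> S" for x
    using bounded_linear.has_derivative[OF assms(2) differentiable_on_has_derivative[OF assms(1) _ that]]
      Suc.prems by simp
  have "Ck_on k S (\<lambda>x. frechet_derivative (\<lambda>x. L (f x)) (at x) v)" for v
    using Suc.IH[of "\<lambda>x. frechet_derivative f (at x) v"] Suc.prems
    by (subst Ck_on_cong[OF assms(1), where g = "\<lambda>x. L (frechet_derivative f (at x) v)"])
      (auto simp: frechet_derivative_at[OF d, symmetric])
  then show ?case
    using d by (auto simp: differentiable_on_def differentiable_def intro: has_derivative_at_withinI)
qed

lemma Ck_on_add:
  assumes "open S" "Ck_on k S f" "Ck_on k S g"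
  shows "Ck_on k S (\<lambda>x. f x + g x)"
  using assms(2,3)
proof (induction k arbitrary: f g)
  case 0
  then show ?case by (simp add: continuous_on_add)
next
  case (Suc k)
  have d: "((\<lambda>x. f x + g x) has_derivative
      (\<lambda>v. frechet_derivative f (at x) v + frechet_derivative g (at x) v)) (at x)"
    if "x \<in> S" for x
    using Suc.prems by (intro has_derivative_add differentiable_on_has_derivative[OF assms(1) _ that]) auto
  have "Ck_on k S (\<lambda>x. frechet_derivative (\<lambda>x. f x + g x) (at x) v)" for v
    using Suc.IH[of "\<lambda>x. frechet_derivative f (at x) v" "\<lambda>x. frechet_derivative g (at x) v"] Suc.prems
    by (subst Ck_on_cong[OF assms(1),
          where g = "\<lambda>x. frechet_derivative f (at x) v + frechet_derivative g (at x) v"])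
      (auto simp: frechet_derivative_at[OF d, symmetric])
  then show ?case
    using d by (auto simp: differentiable_on_def differentiable_def intro: has_derivative_at_withinI)
qed

lemma Ck_on_mult:
  fixes f g :: "'e::euclidean_space \<Rightarrow> 'f::real_normed_algebra"
  assumes "open S" "Ck_on k S f" "Ck_on k S g"
  shows "Ck_on k S (\<lambda>x. f x * g x)"
  using assms(2,3)
proof (induction k arbitrary: f g)
  case 0
  then show ?case by (simp add: continuous_on_mult)
next
  case (Suc k)
  have d: "((\<lambda>x. f x * g x) has_derivative
      (\<lambda>v. f x * frechet_derivative g (at x) v + frechet_derivative f (at x) v * g x)) (at x)"
    if "x \<in> S" for x
    using Suc.prems by (intro has_derivative_mult differentiable_on_has_derivative[OF assms(1) _ that]) auto
  have "Ck_on k S (\<lambda>x. frechet_derivative (\<lambda>x. f x * g x) (at x) v)" for v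
  proof (subst Ck_on_cong[OF assms(1),
          where g = "\<lambda>x. f x * frechet_derivative g (at x) v + frechet_derivative f (at x) v * g x"])
    show "frechet_derivative (\<lambda>x. f x * g x) (at y) v
      = f y * frechet_derivative g (at y) v + frechet_derivative f (at y) v * g y" if "y \<in> S" for y
      by (simp add: frechet_derivative_at[OF d[OF that], symmetric])
    \<comment> \<open>The product rule leaves one factor undifferentiated in each term;
      \<open>Ck_on_SucD\<close> lowers its class from \<open>Suc k\<close> to \<open>k\<close> so
      that the induction hypothesis applies.\<close>
    show "Ck_on k S (\<lambda>x. f x * frechet_derivative g (at x) v + frechet_derivative f (at x) v * g x)"
      using Suc.prems by (intro Ck_on_add[OF assms(1)] Suc.IH Ck_on_SucD[of k S f] Ck_on_SucD[of k S g]) auto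
  qed
  then show ?case
    using d by (auto simp: differentiable_on_def differentiable_def intro: has_derivative_at_withinI)
qed

section \<open>Charts and the algebra of smooth functions\<close>

lemma smooth_atlasD:
  assumes "smooth_atlas \<A>" "(U, \<psi>) \<in> \<A>"
  shows "open U" "open (\<psi> ` U)" "homeomorphism U (\<psi> ` U) \<psi> (inv_into U \<psi>)"
proof -
  have "\<forall>(U, \<psi>)\<in>\<A>. open U \<and> open (\<psi> ` U) \<and> homeomorphism U (\<psi> ` U) \<psi> (inv_into U \<psi>)"
    using assms(1) unfolding smooth_atlas_def by (elim conjE)
  from bspec[OF this assms(2)]
  show "open U" "open (\<psi> ` U)" "homeomorphism U (\<psi> ` U) \<psi> (inv_into U \<psi>)" by simp_all
qed

lemmas smooth_atlas_open = smooth_atlasD(2)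

lemma smooth_atlas_chart:
  assumes "smooth_atlas \<A>"
  obtains U \<psi> where "(U, \<psi>) \<in> \<A>" "x \<in> U"
proof -
  have "(\<Union>(U, \<psi>)\<in>\<A>. U) = UNIV" using assms unfolding smooth_atlas_def by (elim conjE)
  then have "x \<in> (\<Union>(U, \<psi>)\<in>\<A>. U)" by simp
  with that show ?thesis by auto
qed

lemma smooth_funI:
  assumes "\<And>U \<psi> k. (U, \<psi>) \<in> \<A> \<Longrightarrow> Ck_on k (\<psi> ` U) (\<lambda>y. f (inv_into U \<psi> y))"
  shows "smooth_fun \<A> f"
  using assms by (auto simp: smooth_fun_def smooth_on_def comp_def)

lemma smooth_funD:
  assumes "smooth_fun \<A> f" "(U, \<psi>) \<in> \<A>"
  shows "Ck_on k (\<psi> ` U) (\<lambda>y. f (inv_into U \<psi> y))"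
  using bspec[OF assms(1)[unfolded smooth_fun_def] assms(2)] by (simp add: smooth_on_def comp_def)

lemma smooth_fun_const: "smooth_fun \<A> (\<lambda>x. c)"
  by (rule smooth_funI) (rule Ck_on_const)

lemma smooth_fun_zero [simp]: "smooth_fun \<A> 0"
  using smooth_fun_const[of \<A> 0] by (simp add: zero_fun_def)

lemma smooth_fun_one [simp]: "smooth_fun \<A> 1"
  using smooth_fun_const[of \<A> 1] by (simp add: one_fun_def)

lemma smooth_fun_add:
  assumes "smooth_atlas \<A>" "smooth_fun \<A> f" "smooth_fun \<A> g"
  shows "smooth_fun \<A> (f + g)"
  unfolding plus_fun_def
  by (rule smooth_funI, rule Ck_on_add)
    (erule smooth_atlas_open[OF assms(1)] smooth_funD[OF assms(2)] smooth_funD[OF assms(3)])+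

lemma smooth_fun_mult:
  assumes "smooth_atlas \<A>" "smooth_fun \<A> f" "smooth_fun \<A> g"
  shows "smooth_fun \<A> (f * g)"
  unfolding times_fun_def
  by (rule smooth_funI, rule Ck_on_mult)
    (erule smooth_atlas_open[OF assms(1)] smooth_funD[OF assms(2)] smooth_funD[OF assms(3)])+

lemma smooth_fun_cnj:
  assumes "smooth_atlas \<A>" "smooth_fun \<A> f"
  shows "smooth_fun \<A> (\<lambda>x. cnj (f x))"
  by (rule smooth_funI, rule Ck_on_linear[OF _ bounded_linear_cnj])
    (erule smooth_atlas_open[OF assms(1)] smooth_funD[OF assms(2)])+

lemma smooth_fun_sum:
  assumes "smooth_atlas \<A>" "\<And>i. i \<in> I \<Longrightarrow> smooth_fun \<A> (f i)"
  shows "smooth_fun \<A> (\<Sum>i\<in>I. f i)"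
  using assms(2) by (induction I rule: infinite_finite_induct) (auto intro: smooth_fun_add[OF assms(1)])

lemma smooth_fun_scale:
  assumes "smooth_atlas \<A>" "smooth_fun \<A> f"
  shows "smooth_fun \<A> (\<lambda>x. c * f x)"
  using smooth_fun_mult[OF assms(1) smooth_fun_const assms(2)] by (simp add: times_fun_def)

lemma smooth_fun_uminus:
  assumes "smooth_atlas \<A>" "smooth_fun \<A> f"
  shows "smooth_fun \<A> (- f)"
  using smooth_fun_scale[OF assms, of "-1"] by (simp add: fun_Compl_def)

section \<open>Tangent vectors and constancy on a connected manifold\<close>

lemma tangent_space_zero: "(\<lambda>f. 0) \<in> tangent_space \<A> x"
  by (simp add: tangent_space_def)

text \<open>Simple connectedness makes any two loops freely homotopic, even constant loops at
  different points; the track of the base point under such a homotopy is a path joining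
  them.\<close>

lemma simply_connected_UNIV_imp_connected:
  assumes "simply_connected (UNIV :: 'm::topological_space set)"
  shows "connected (UNIV :: 'm set)"
proof -
  have "\<exists>g. path g \<and> pathstart g = a \<and> pathfinish g = b" for a b :: 'm
  proof -
    have "homotopic_loops UNIV (\<lambda>_. a) (\<lambda>_. b)"
      using assms unfolding simply_connected_def
      by (simp add: path_def pathstart_def pathfinish_def)
    then obtain h :: "real \<times> real \<Rightarrow> 'm"
      where h: "continuous_on ({0..1} \<times> {0..1}) h" "\<forall>t\<in>{0..1}. h (0, t) = a" "\<forall>t\<in>{0..1}. h (1, t) = b"
      unfolding homotopic_loops by blast
    have "continuous_on {0..1} (\<lambda>t. h (t, 0))"
      by (rule continuous_on_compose2[OF h(1)]) (auto intro!: continuous_intros)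
    with h(2,3) show ?thesis
      by (intro exI[of _ "\<lambda>t. h (t, 0)"]) (simp add: path_def pathstart_def pathfinish_def)
  qed
  then show ?thesis
    by (intro path_connected_imp_connected) (simp add: path_connected_def)
qed

text \<open>A \<open>vfield\<close> may be discontinuous, so one tangent vector extends by zero to
  all other points. Equations assumed for every \<open>vfield\<close> can thus be tested vector by
  vector.\<close>

lemma vfield_through:
  assumes "v \<in> tangent_space \<A> x"
  obtains X where "vfield \<A> X" "X x = v"
  using assms tangent_space_zero
  by (intro that[of "\<lambda>y. if y = x then v else (\<lambda>f. 0)"]) (auto simp: vfield_def)

text \<open>Tangent vectors are characterized by derivation laws. Directional derivatives in a chart
  satisfy them, which supplies enough tangent vectors to detect a vanishing derivative.\<close>

lemma chart_directional_derivative_tangent: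
  assumes \<A>: "smooth_atlas \<A>" and ch: "(U, \<psi>) \<in> \<A>" and x: "x \<in> U"
  shows "(\<lambda>f. if smooth_fun \<A> f then frechet_derivative (f \<circ> inv_into U \<psi>) (at (\<psi> x)) e else 0)
      \<in> tangent_space \<A> x"
proof -
  have inv: "inv_into U \<psi> (\<psi> x) = x"
    using smooth_atlasD(3)[OF \<A> ch] x by (simp add: homeomorphism_def)
  have D: "((\<lambda>y. f (inv_into U \<psi> y)) has_derivative
      frechet_derivative (\<lambda>y. f (inv_into U \<psi> y)) (at (\<psi> x))) (at (\<psi> x))"
    if "smooth_fun \<A> f" for f
  proof -
    have "(\<lambda>y. f (inv_into U \<psi> y)) differentiable_on \<psi> ` U"
      using smooth_funD[OF that ch, of "Suc 0"] by simp
    from differentiable_on_has_derivative[OF smooth_atlas_open[OF \<A> ch] this] x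
    show ?thesis by (simp add: comp_def)
  qed
  show ?thesis
    unfolding tangent_space_def comp_def
  proof (safe, goal_cases)
    case (1 f g)
    then show ?case
      using frechet_derivative_at[OF has_derivative_add[OF D D], of f g, symmetric]
      by (simp add: smooth_fun_add[OF \<A>])
  next
    case (2 f g)
    then show ?case
      using frechet_derivative_at[OF has_derivative_mult[OF D D], of f g, symmetric]
      by (simp add: smooth_fun_mult[OF \<A>] inv)
  next
    case (3 c f)
    then show ?case
      using frechet_derivative_at[OF has_derivative_mult_right[OF D], of f c, symmetric]
      by (simp add: smooth_fun_scale[OF \<A>])
  next
    case (4 f)
    then show ?case
      using frechet_derivative_at[OF bounded_linear.has_derivative[OF bounded_linear_cnj D], of f, symmetric]
      by (simp add: smooth_fun_cnj[OF \<A>])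
  next
    case 5
    then show ?case by simp
  qed
qed

text \<open>In a chart all directional derivatives vanish, so \<open>f\<close> is constant on the
  preimage of a ball; connectedness leads from locally constant to constant.\<close>

lemma constant_if_tangent_vectors_vanish:
  fixes \<A> :: "('m::{t2_space,second_countable_topology}, 'e::euclidean_space) chart set"
  assumes \<A>: "smooth_atlas \<A>" and con: "connected (UNIV :: 'm set)"
    and f: "smooth_fun \<A> f" and zero: "\<And>x v. v \<in> tangent_space \<A> x \<Longrightarrow> v f = 0"
  shows "\<exists>c. f = (\<lambda>x. c)"
proof -
  have "f constant_on UNIV"
  proof (rule locally_constant_imp_constant[OF con])
    fix x :: 'm
    obtain U \<psi> where ch: "(U, \<psi>) \<in> \<A>" and x: "x \<in> U"
      by (rule smooth_atlas_chart[OF \<A>])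
    have U: "open U" "open (\<psi> ` U)" "homeomorphism U (\<psi> ` U) \<psi> (inv_into U \<psi>)"
      using smooth_atlasD[OF \<A> ch] .
    have inv: "\<And>y. y \<in> U \<Longrightarrow> inv_into U \<psi> (\<psi> y) = y"
      using U(3) by (simp add: homeomorphism_def)
    obtain e where e: "e > 0" "ball (\<psi> x) e \<subseteq> \<psi> ` U"
      using U(2) x by (meson imageI open_contains_ball)
    let ?g = "f \<circ> inv_into U \<psi>"
    have dg: "?g differentiable_on \<psi> ` U"
      using smooth_funD[OF f ch, of "Suc 0"] by (simp add: comp_def)
    have d0: "(?g has_derivative (\<lambda>h. 0)) (at z)" if z: "z \<in> \<psi> ` U" for z
    proof -
      obtain y where y: "z = \<psi> y" "y \<in> U" by (rule imageE[OF z])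
      have "frechet_derivative ?g (at z) h = 0" for h
        using zero[OF chart_directional_derivative_tangent[OF \<A> ch y(2), of h]] f y(1) by simp
      then have "frechet_derivative ?g (at z) = (\<lambda>h. 0)" by (rule ext)
      then show ?thesis
        using differentiable_on_has_derivative[OF U(2) dg z] by (simp only:)
    qed
    have gc: "?g z = ?g (\<psi> x)" if "z \<in> ball (\<psi> x) e" for z
    proof (rule has_derivative_zero_unique[OF convex_ball _ that, of ?g])
      show "\<psi> x \<in> ball (\<psi> x) e" using e by simp
      show "(?g has_derivative (\<lambda>h. 0)) (at y within ball (\<psi> x) e)" if "y \<in> ball (\<psi> x) e" for y
        using that e d0 by (blast intro: has_derivative_at_withinI)
    qed
    let ?V = "U \<inter> \<psi> -` ball (\<psi> x) e"
    have "continuous_on U \<psi>" using U(3) by (simp add: homeomorphism_def)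
    then have "open ?V" using U(1) open_ball by (rule continuous_open_preimage)
    moreover have "x \<in> ?V" using x e by simp
    moreover have fx: "f y = f x" if "y \<in> ?V" for y
      using gc[of "\<psi> y"] inv[of y] inv[OF x] that by simp
    ultimately show "\<exists>T. openin (top_of_set UNIV) T \<and> x \<in> T \<and> (\<forall>y\<in>T. f y = f x)"
      by (intro exI[of _ ?V] conjI ballI fx) (simp_all only: subtopology_UNIV open_openin)
  qed
  then show ?thesis by (auto simp: constant_on_def)
qed

section \<open>Differentiation of Laurent series\<close>

text \<open>The bounds \<open>k\<close> and \<open>l\<close> may lie below the subdegrees. Several
  products can therefore be written over one index range, and at exponent \<open>k + l\<close> a
  single product of coefficients remains.\<close>

lemma fls_times_nth_bounds:
  fixes f g :: "'a::semiring_0 fls"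
  assumes "\<And>i. i < k \<Longrightarrow> fls_nth f i = 0" "\<And>i. i < l \<Longrightarrow> fls_nth g i = 0"
  shows "fls_nth (f * g) n = (\<Sum>i=k..n - l. fls_nth f i * fls_nth g (n - i))"
proof -
  have z: "fls_nth f i * fls_nth g (n - i) = 0"
    if "i < fls_subdegree f \<or> n - fls_subdegree g < i \<or> i < k \<or> n - l < i" for i
  proof -
    have "fls_nth f i = 0 \<or> fls_nth g (n - i) = 0"
      using that assms(1)[of i] assms(2)[of "n - i"] by auto
    then show ?thesis by auto
  qed
  show ?thesis
    unfolding fls_times_nth(2)
    by (rule sum.mono_neutral_cong) (use z in auto)
qed

lemma sum_fun_apply: "(\<Sum>i\<in>I. f i) x = (\<Sum>i\<in>I. f i x)"
  by (induction I rule: infinite_finite_induct) auto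

lemma cst_numeral: "cst (numeral n) = numeral n"
  by (simp flip: numeral_fun)

lemma cst_0: "cst 0 = 0" and cst_1: "cst 1 = 1"
  by (simp_all flip: zero_fun_def one_fun_def)

lemma cst_mult: "cst (z * w) = cst z * cst w" and cst_uminus: "cst (- z) = - cst z"
  by (rule fls_eqI, auto simp: fun_eq_iff)+

section \<open>Derivations and the Leibniz rule for series\<close>

lemma tangent_space_add:
  "v \<in> tangent_space \<A> x \<Longrightarrow> smooth_fun \<A> f \<Longrightarrow> smooth_fun \<A> g \<Longrightarrow> v (f + g) = v f + v g"
  and tangent_space_mult:
  "v \<in> tangent_space \<A> x \<Longrightarrow> smooth_fun \<A> f \<Longrightarrow> smooth_fun \<A> g \<Longrightarrow>
    v (f * g) = f x * v g + v f * g x"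
  and tangent_space_scale:
  "v \<in> tangent_space \<A> x \<Longrightarrow> smooth_fun \<A> f \<Longrightarrow> v (\<lambda>y. c * f y) = c * v f"
  by (simp_all add: tangent_space_def)

lemma tangent_space_at_zero:
  assumes "v \<in> tangent_space \<A> x"
  shows "v 0 = 0"
  using tangent_space_scale[OF assms smooth_fun_zero, of 0] by (simp add: zero_fun_def)

lemma tangent_space_at_const:
  assumes "v \<in> tangent_space \<A> x"
  shows "v (\<lambda>_. c) = 0"
proof -
  have "v 1 = 0" using tangent_space_mult[OF assms, of 1 1] by simp
  then show ?thesis using tangent_space_scale[OF assms smooth_fun_one, of c] by simp
qed

lemma tangent_space_sum:
  assumes "smooth_atlas \<A>" "v \<in> tangent_space \<A> x" "\<And>i. i \<in> I \<Longrightarrow> smooth_fun \<A> (f i)"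
  shows "v (\<Sum>i\<in>I. f i) = (\<Sum>i\<in>I. v (f i))"
  using assms(3)
  by (induction I rule: infinite_finite_induct)
    (simp_all add: tangent_space_at_zero[OF assms(2)] tangent_space_add[OF assms(2)]
      smooth_fun_sum[OF assms(1)])

locale vector_field =
  fixes \<A> :: "('m::{t2_space,second_countable_topology}, 'e::euclidean_space) chart set"
    and X :: "'m vfield"
  assumes atlas: "smooth_atlas \<A>" and X: "vfield \<A> X"
begin

lemma tangent: "X x \<in> tangent_space \<A> x"
  using X by (simp add: vfield_def)

lemmas X_simps = tangent_space_at_zero[OF tangent] tangent_space_at_const[OF tangent]
  tangent_space_add[OF tangent] tangent_space_mult[OF tangent] tangent_space_scale[OF tangent]
  tangent_space_sum[OF atlas tangent]

text \<open>A derivation kills the zero function, so \<open>fls_subdegree s\<close> still bounds the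
  exponents from below and \<open>Abs_fls\<close> is applied to a genuine Laurent series.\<close>

lemma d_ser_nth: "fls_nth (d_ser X s) n = (\<lambda>x. X x (fls_nth s n))"
  unfolding d_ser_def
  by (rule nth_Abs_fls_lower_bound[of "fls_subdegree s"]) (auto simp: X_simps zero_fun_def)

lemma d_ser_add: "smooth_ser \<A> s \<Longrightarrow> smooth_ser \<A> t \<Longrightarrow> d_ser X (s + t) = d_ser X s + d_ser X t"
  by (rule fls_eqI, rule ext) (simp add: d_ser_nth smooth_ser_def X_simps)

lemma d_ser_fls_const: "d_ser X (fls_const f) = fls_const (d_fun X f)"
  by (rule fls_eqI) (auto simp: d_ser_nth d_fun_def X_simps zero_fun_def)

lemma d_ser_cst: "d_ser X (cst z) = 0"
  by (rule fls_eqI) (auto simp: d_ser_nth X_simps zero_fun_def)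

lemma d_ser_0: "d_ser X 0 = 0"
  by (rule fls_eqI) (auto simp: d_ser_nth X_simps zero_fun_def)

lemma d_ser_numeral: "d_ser X (numeral n) = 0"
  using d_ser_cst[of "numeral n"] by (simp only: cst_numeral)

lemma d_ser_lam: "d_ser X (lam k) = 0"
  by (rule fls_eqI) (auto simp: d_ser_nth X_simps zero_fun_def one_fun_def)

lemma d_ser_mult:
  assumes "smooth_ser \<A> s" "smooth_ser \<A> t"
  shows "d_ser X (s * t) = d_ser X s * t + s * d_ser X t"
proof (rule fls_eqI)
  fix n
  let ?k = "fls_subdegree s" and ?l = "fls_subdegree t"
  have z: "fls_nth (d_ser X s) i = 0" if "i < ?k" for i
    using that by (simp add: d_ser_nth X_simps zero_fun_def)
  have z': "fls_nth (d_ser X t) i = 0" if "i < ?l" for i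
    using that by (simp add: d_ser_nth X_simps zero_fun_def)
  \<comment> \<open>\<open>d_ser X s\<close> may start at a higher power than \<open>s\<close>.
    Taking the subdegrees of \<open>s\<close> and \<open>t\<close> as bounds in all three products
    gives them the same range, so they can be compared term by term.\<close>
  have m: "fls_nth (s * t) n = (\<Sum>i=?k..n - ?l. fls_nth s i * fls_nth t (n - i))"
    "fls_nth (d_ser X s * t) n = (\<Sum>i=?k..n - ?l. fls_nth (d_ser X s) i * fls_nth t (n - i))"
    "fls_nth (s * d_ser X t) n = (\<Sum>i=?k..n - ?l. fls_nth s i * fls_nth (d_ser X t) (n - i))"
    by (rule fls_times_nth_bounds; simp add: z z')+
  have D: "X x (fls_nth (s * t) n) = (\<Sum>i=?k..n - ?l. X x (fls_nth s i * fls_nth t (n - i)))" for x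
    unfolding m using assms by (intro X_simps smooth_fun_mult[OF atlas]) (auto simp: smooth_ser_def)
  have D': "X x (fls_nth s i * fls_nth t (n - i))
      = fls_nth s i x * X x (fls_nth t (n - i)) + X x (fls_nth s i) * fls_nth t (n - i) x" for x i
    using assms by (simp add: X_simps smooth_ser_def)
  show "fls_nth (d_ser X (s * t)) n = fls_nth (d_ser X s * t + s * d_ser X t) n"
  proof (rule ext)
    fix x
    show "fls_nth (d_ser X (s * t)) n x = fls_nth (d_ser X s * t + s * d_ser X t) n x"
      unfolding d_ser_nth[of "s * t"] fls_plus_nth m(2,3) D D'
      by (simp add: d_ser_nth sum.distrib sum_fun_apply)
  qed
qed

end

section \<open>Order and parity in the formal parameter\<close>

text \<open>The single integer \<open>k\<close> records both the order and the parity in \<open>\<lambda>\<close>.\<close>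

definition graded ::
  "('m::{t2_space,second_countable_topology}, 'e::euclidean_space) chart set \<Rightarrow> int \<Rightarrow> 'm lser \<Rightarrow> bool" where
  "graded \<A> k s \<longleftrightarrow> smooth_ser \<A> s \<and> (\<forall>n. fls_nth s n \<noteq> 0 \<longrightarrow> k \<le> n \<and> even (n - k))"

lemma graded_smooth: "graded \<A> k s \<Longrightarrow> smooth_ser \<A> s"
  by (simp add: graded_def)

lemma graded_0: "graded \<A> k 0"
  by (simp add: graded_def smooth_ser_def)

lemma graded_const: "smooth_fun \<A> f \<Longrightarrow> graded \<A> 0 (fls_const f)"
  by (auto simp: graded_def smooth_ser_def)

lemma graded_cst: "graded \<A> 0 (cst z)"
  by (rule graded_const) (rule smooth_fun_const)

lemma graded_numeral: "graded \<A> 0 (numeral n)"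
  using graded_cst[of \<A> "numeral n"] by (simp only: cst_numeral)

lemma graded_lam: "graded \<A> k (lam k)"
  by (auto simp: graded_def smooth_ser_def)

lemma graded_mono: "graded \<A> l s \<Longrightarrow> k \<le> l \<Longrightarrow> even (l - k) \<Longrightarrow> graded \<A> k s"
  by (fastforce simp: graded_def)

lemma graded_add:
  assumes "smooth_atlas \<A>" "graded \<A> k s" "graded \<A> k t"
  shows "graded \<A> k (s + t)"
proof -
  have "k \<le> n \<and> even (n - k)" if "fls_nth s n + fls_nth t n \<noteq> 0" for n
    using that assms(2,3) unfolding graded_def by (cases "fls_nth s n = 0") simp_all
  then show ?thesis
    using assms by (simp add: graded_def smooth_ser_def smooth_fun_add)
qed

lemma smooth_ser_mult:
  assumes "smooth_atlas \<A>" "smooth_ser \<A> s" "smooth_ser \<A> t"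
  shows "smooth_ser \<A> (s * t)"
  using assms unfolding smooth_ser_def fls_times_nth(2)
  by (intro allI smooth_fun_sum smooth_fun_mult) auto

lemma graded_mult:
  assumes "smooth_atlas \<A>" "graded \<A> k s" "graded \<A> l t"
  shows "graded \<A> (k + l) (s * t)"
proof -
  have "k + l \<le> n \<and> even (n - (k + l))" if "fls_nth (s * t) n \<noteq> 0" for n
  proof -
    obtain i where "fls_nth s i * fls_nth t (n - i) \<noteq> 0"
      using \<open>fls_nth (s * t) n \<noteq> 0\<close> unfolding fls_times_nth(2) by (metis (no_types, lifting) sum.not_neutral_contains_not_neutral)
    then have "fls_nth s i \<noteq> 0" "fls_nth t (n - i) \<noteq> 0" by auto
    then have "k \<le> i" "even (i - k)" "l \<le> n - i" "even (n - i - l)"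
      using assms(2,3) by (auto simp: graded_def)
    then show ?thesis by auto
  qed
  then show ?thesis
    using assms by (simp add: graded_def smooth_ser_mult)
qed

lemma graded_mult':
  assumes "smooth_atlas \<A>" "graded \<A> k s" "graded \<A> l t" "m \<le> k + l" "even (k + l - m)"
  shows "graded \<A> m (s * t)"
  using graded_mono[OF graded_mult[OF assms(1-3)] assms(4,5)] .

lemma graded_uminus:
  assumes "smooth_atlas \<A>" "graded \<A> k s"
  shows "graded \<A> k (- s)"
  using graded_mult[OF assms(1) graded_cst assms(2), of "-1"] by (simp add: cst_uminus cst_1)

lemma graded_diff:
  assumes "smooth_atlas \<A>" "graded \<A> k s" "graded \<A> k t"
  shows "graded \<A> k (s - t)"
  using graded_add[OF assms(1,2) graded_uminus[OF assms(1,3)]] by simp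

lemma graded_nth_below: "graded \<A> k s \<Longrightarrow> n < k \<Longrightarrow> fls_nth s n = 0"
  and graded_nth_parity: "graded \<A> k s \<Longrightarrow> odd (n - k) \<Longrightarrow> fls_nth s n = 0"
  by (fastforce simp: graded_def)+

text \<open>Functions on \<open>M\<close> have zero divisors but no nilpotents, which suffices to
  compare the lowest coefficients of a series and of its square.\<close>

lemma fun_mult_self_eq_0: "f * f = 0 \<Longrightarrow> f = (0 :: 'm \<Rightarrow> complex)"
  by (simp add: fun_eq_iff)

text \<open>For square roots and inverses, the coefficients of the wrong parity solve linear recursions
  whose leading coefficient is invertible.\<close>

lemma graded_sqrt:
  fixes r :: "'m::{t2_space,second_countable_topology} lser"
  assumes r: "smooth_ser \<A> r" and bc: "graded \<A> 2 (r\<^sup>2)" and lead: "fls_nth (r\<^sup>2) 2 = (\<lambda>_. g)" and g: "g \<noteq> 0"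
  shows "graded \<A> 1 r" "fls_nth r 1 * fls_nth r 1 = (\<lambda>_. g)"
proof -
  have sq: "fls_nth (r\<^sup>2) (k + k) = fls_nth r k * fls_nth r k"
    if "\<And>i. i < k \<Longrightarrow> fls_nth r i = 0" for k
    unfolding power2_eq_square by (subst fls_times_nth_bounds[of k _ k]) (simp_all add: that)
  \<comment> \<open>A subdegree \<open>d\<close> below 1 would put the square of the lowest
    coefficient at exponent \<open>d + d < 2\<close>, where the square of \<open>r\<close> has no
    term.\<close>
  have below: "fls_nth r n = 0" if "n < 1" for n
  proof (rule ccontr)
    assume "fls_nth r n \<noteq> 0"
    then have nz: "r \<noteq> 0" and "fls_subdegree r \<le> n" by (auto intro: fls_subdegree_leI)
    with that have "fls_subdegree r + fls_subdegree r < 2" by simp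
    with bc sq[of "fls_subdegree r"] have "fls_nth r (fls_subdegree r) * fls_nth r (fls_subdegree r) = 0"
      by (simp add: graded_nth_below)
    with nz show False using fun_mult_self_eq_0 nth_fls_subdegree_nonzero by blast
  qed
  show lead1: "fls_nth r 1 * fls_nth r 1 = (\<lambda>_. g)"
    using sq[of 1] below lead by simp
  have even0: "fls_nth r (2 * int k) = 0" for k
  proof (induction k rule: less_induct)
    case (less k)
    show ?case
    proof (cases "k = 0")
      case True
      then show ?thesis using below[of 0] by simp
    next
      case False
      \<comment> \<open>In the coefficient of \<open>r\<^sup>2\<close> at the odd exponent
        \<open>2 * k + 1\<close>, each product pairs an even with an odd exponent. The unknown even
        coefficient occurs for \<open>i = 1\<close> and \<open>i = 2 * k\<close>; every other
        product contains an even coefficient that is already known to vanish.\<close>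
      let ?t = "\<lambda>i. fls_nth r i * fls_nth r (2 * int k + 1 - i)"
      have "?t i = 0" if "i \<in> {1..2 * int k} - {1, 2 * int k}" for i
      proof (cases "even i")
        case True
        then obtain j where "i = 2 * j" by blast
        with that less.IH[of "nat j"] show ?thesis by auto
      next
        case False
        then obtain j where "i = 2 * j + 1" by (meson oddE)
        with that less.IH[of "nat (int k - j)"] show ?thesis by auto
      qed
      then have "(\<Sum>i=1..2 * int k. ?t i) = (\<Sum>i\<in>{1, 2 * int k}. ?t i)"
        using False by (intro sum.mono_neutral_right) auto
      also have "\<dots> = 2 * (fls_nth r 1 * fls_nth r (2 * int k))"
        using False by (simp add: mult.commute)
      also have "(\<Sum>i=1..2 * int k. ?t i) = fls_nth (r\<^sup>2) (2 * int k + 1)"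
        using fls_times_nth_bounds[of 1 r 1 r] below by (simp add: power2_eq_square)
      also have "\<dots> = 0" using bc by (simp add: graded_nth_parity)
      \<comment> \<open>A second factor \<open>fls_nth r 1\<close> turns the leading coefficient
        into its square, the nonzero constant \<open>g\<close>.\<close>
      finally have "fls_nth r 1 * (fls_nth r 1 * fls_nth r (2 * int k)) = 0"
        by (simp add: numeral_fun fun_eq_iff)
      then show ?thesis
        using g by (simp add: lead1 fun_eq_iff flip: mult.assoc)
    qed
  qed
  have "1 \<le> n \<and> even (n - 1)" if nz: "fls_nth r n \<noteq> 0" for n
  proof
    show n: "1 \<le> n" using below nz by (meson not_le)
    show "even (n - 1)"
    proof (rule ccontr)
      assume "odd (n - 1)"
      then obtain j where "n = 2 * j" by (auto elim: oddE)
      with n nz even0[of "nat j"] show False by simp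
    qed
  qed
  then show "graded \<A> 1 r" using r by (simp add: graded_def)
qed

lemma graded_inverse:
  fixes r \<kappa> :: "'m::{t2_space,second_countable_topology} lser"
  assumes \<A>: "smooth_atlas \<A>" and r: "graded \<A> 1 r" and inv: "\<kappa> * r = 1"
    and u: "smooth_fun \<A> u" "fls_nth r 1 * u = 1"
  shows "graded \<A> (-1) \<kappa>"
proof -
  have rb: "fls_nth r i = 0" if "i < 1" for i using r that by (rule graded_nth_below)
  have unit: "f = 0" if "f * fls_nth r 1 = 0" for f
  proof -
    have "f = (f * fls_nth r 1) * u" using u(2) by (simp add: mult.assoc)
    with that show ?thesis by simp
  qed
  have below: "fls_nth \<kappa> n = 0" if "n < -1" for n
  proof (rule ccontr)
    assume "fls_nth \<kappa> n \<noteq> 0"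
    then have nz: "\<kappa> \<noteq> 0" and d: "fls_subdegree \<kappa> \<le> n" by (auto intro: fls_subdegree_leI)
    have "fls_nth (\<kappa> * r) (fls_subdegree \<kappa> + 1) = fls_nth \<kappa> (fls_subdegree \<kappa>) * fls_nth r 1"
      by (subst fls_times_nth_bounds[of "fls_subdegree \<kappa>" _ 1]) (simp_all add: rb)
    then show False using inv unit[of "fls_nth \<kappa> (fls_subdegree \<kappa>)"] nz d that by simp
  qed
  have rec: "fls_nth \<kappa> n * fls_nth r 1
      = (if n = -1 then 1 else 0) - (\<Sum>i=-1..n - 1. fls_nth \<kappa> i * fls_nth r (n + 1 - i))"
    if "-1 \<le> n" for n
  proof -
    have "fls_nth (\<kappa> * r) (n + 1) = (\<Sum>i=-1..n. fls_nth \<kappa> i * fls_nth r (n + 1 - i))"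
      by (subst fls_times_nth_bounds[of "-1" _ 1]) (simp_all add: rb below)
    also have "{-1..n} = insert n {-1..n - 1}" using that by auto
    also have "(\<Sum>i\<in>insert n {-1..n - 1}. fls_nth \<kappa> i * fls_nth r (n + 1 - i))
        = fls_nth \<kappa> n * fls_nth r (n + 1 - n) + (\<Sum>i=-1..n - 1. fls_nth \<kappa> i * fls_nth r (n + 1 - i))"
      by (rule sum.insert) auto
    also have "n + 1 - n = 1" by simp
    finally have "fls_nth (\<kappa> * r) (n + 1)
        = fls_nth \<kappa> n * fls_nth r 1 + (\<Sum>i=-1..n - 1. fls_nth \<kappa> i * fls_nth r (n + 1 - i))" .
    moreover have "fls_nth (\<kappa> * r) (n + 1) = (if n = -1 then 1 else 0)"
      by (auto simp: inv)
    ultimately show ?thesis by (simp only: eq_diff_eq)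
  qed
  \<comment> \<open>The index \<open>k\<close> counts exponents from -1, so the wrong parity, an
    even exponent, is an odd \<open>k\<close>. The same recursion yields smoothness, which is not
    assumed of \<kappa>.\<close>
  have "smooth_fun \<A> (fls_nth \<kappa> (int k - 1)) \<and> (odd k \<longrightarrow> fls_nth \<kappa> (int k - 1) = 0)" for k
  proof (induction k rule: less_induct)
    case (less k)
    have IH: "smooth_fun \<A> (fls_nth \<kappa> i)" "even i \<Longrightarrow> fls_nth \<kappa> i = 0"
      if "i \<in> {-1..int k - 1 - 1}" for i
      using less.IH[of "nat (i + 1)"] that by (auto simp: even_nat_iff)
    have e: "fls_nth \<kappa> (int k - 1) = (fls_nth \<kappa> (int k - 1) * fls_nth r 1) * u"
      using u(2) by (simp add: mult.assoc)
    let ?w = "(if int k - 1 = -1 then 1 else 0)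
        - (\<Sum>i=-1..int k - 1 - 1. fls_nth \<kappa> i * fls_nth r (int k - 1 + 1 - i))"
    have "smooth_fun \<A> (\<Sum>i=-1..int k - 1 - 1. fls_nth \<kappa> i * fls_nth r (int k - 1 + 1 - i))"
      using IH(1) r by (intro smooth_fun_sum[OF \<A>] smooth_fun_mult[OF \<A>]) (auto simp: graded_def smooth_ser_def)
    then have "smooth_fun \<A> (((if int k - 1 = -1 then 1 else 0)
        + - (\<Sum>i=-1..int k - 1 - 1. fls_nth \<kappa> i * fls_nth r (int k - 1 + 1 - i))) * u)"
      by (intro smooth_fun_mult[OF \<A>] smooth_fun_add[OF \<A>] smooth_fun_uminus[OF \<A>] u(1)) auto
    then have 1: "smooth_fun \<A> (fls_nth \<kappa> (int k - 1))"
      by (subst e, subst rec) simp_all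
    have "fls_nth \<kappa> i * fls_nth r (int k - 1 + 1 - i) = 0" if "odd k" "i \<in> {-1..int k - 1 - 1}" for i
      using IH(2)[of i] graded_nth_parity[OF r, of "int k - 1 + 1 - i"] that by (cases "even i") auto
    then have "fls_nth \<kappa> (int k - 1) = 0" if "odd k"
      using that by (subst e, subst rec) (auto intro!: sum.neutral)
    with 1 show ?case by simp
  qed
  note * = this
  have "smooth_fun \<A> (fls_nth \<kappa> n) \<and> (fls_nth \<kappa> n \<noteq> 0 \<longrightarrow> -1 \<le> n \<and> even (n - -1))" for n
  proof (cases "n < -1")
    case True
    then show ?thesis by (simp add: below)
  next
    case False
    then show ?thesis using *[of "nat (n + 1)"] by (auto simp: even_nat_iff)
  qed
  then show ?thesis by (simp add: graded_def smooth_ser_def)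
qed

section \<open>Hyperbolic functions of a power series\<close>

text \<open>Evaluation at a point of \<open>M\<close> leads to complex power series, where the
  identities of \<open>fps_exp\<close> are available.\<close>

definition fps_at :: "'m \<Rightarrow> ('m \<Rightarrow> 'a) fps \<Rightarrow> 'a::comm_ring_1 fps" where
  "fps_at x F = Abs_fps (\<lambda>n. fps_nth F n x)"

lemma fps_at_nth [simp]: "fps_nth (fps_at x F) n = fps_nth F n x"
  by (simp add: fps_at_def)

lemma fps_at_mult: "fps_at x (F * G) = fps_at x F * fps_at x G"
  and fps_at_one: "fps_at x 1 = 1"
  by (simp_all add: fps_eq_iff fps_mult_nth sum_fun_apply)

lemma fps_at_power: "fps_at x (F ^ n) = fps_at x F ^ n"
  by (induction n) (simp_all add: fps_at_mult fps_at_one)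

lemma fps_at_compose: "fps_at x (F oo G) = fps_at x F oo fps_at x G"
  by (simp add: fps_eq_iff fps_compose_nth sum_fun_apply flip: fps_at_power)

lemma fps_at_eqI: "(\<And>x. fps_at x F = fps_at x G) \<Longrightarrow> F = G"
  by (auto simp: fps_eq_iff fun_eq_iff)

text \<open>The difference of squares factors as (cosh + sinh)(cosh - sinh), and at each point the
  factors are the exponentials of \<open>fps_X * p\<close> and of its negative.\<close>

lemma cosh_lam_sinh_lam: "cosh_lam p * cosh_lam p - sinh_lam p * sinh_lam p = 1"
proof -
  let ?c = "Abs_fps (\<lambda>n (_::'a). if even n then 1 / fact n else 0 :: complex)"
  let ?s = "Abs_fps (\<lambda>n (_::'a). if odd n then 1 / fact n else 0 :: complex)"
  let ?q = "fps_X * p"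
  have "((?c oo ?q) + (?s oo ?q)) * ((?c oo ?q) - (?s oo ?q)) = 1"
  proof (rule fps_at_eqI)
    fix x
    have e: "fps_at x (?c + ?s) = fps_exp 1" "fps_at x (?c - ?s) = fps_exp (-1)"
      by (auto simp: fps_eq_iff)
    have "fps_at x (((?c oo ?q) + (?s oo ?q)) * ((?c oo ?q) - (?s oo ?q)))
        = (fps_exp 1 oo fps_at x ?q) * (fps_exp (-1) oo fps_at x ?q)"
      by (simp only: fps_at_mult e fps_at_compose flip: fps_compose_add_distrib fps_compose_sub_distrib)
    also have "\<dots> = (fps_exp 1 * fps_exp (-1)) oo fps_at x ?q"
      by (rule fps_compose_mult_distrib[symmetric]) simp
    also have "fps_exp 1 * fps_exp (-1) = (1 :: complex fps)"
      by (simp flip: fps_exp_add_mult)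
    finally show "fps_at x (((?c oo ?q) + (?s oo ?q)) * ((?c oo ?q) - (?s oo ?q))) = fps_at x 1"
      by (simp add: fps_at_one)
  qed
  then have "fps_to_fls (((?c oo ?q) + (?s oo ?q)) * ((?c oo ?q) - (?s oo ?q))) = 1"
    by simp
  then show ?thesis
    unfolding cosh_lam_def sinh_lam_def by (simp add: fls_times_fps_to_fls algebra_simps)
qed

text \<open>Without a constant term, \<open>q ^ i\<close> starts at exponent \<open>i\<close> or
  later, so each coefficient of the composition is seen by a finite partial sum. Derivatives and
  gradings of compositions are thereby reduced to polynomials in \<open>q\<close>.\<close>

lemma fls_nth_fps_compose:
  fixes q :: "('m \<Rightarrow> complex) fps"
  assumes q: "fps_nth q 0 = 0" and n: "n \<le> int N"
  shows "fls_nth (fps_to_fls (Abs_fps (\<lambda>n _. \<alpha> n) oo q)) n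
      = fls_nth (\<Sum>i\<le>N. cst (\<alpha> i) * fps_to_fls q ^ i) n"
proof (cases "n < 0")
  case True
  then show ?thesis by (simp add: fls_nth_sum flip: fps_to_fls_power)
next
  case False
  have "fps_nth (q ^ i) (nat n) = 0" if "nat n < i" for i
    using startsby_zero_power_prefix[OF q, of i] that by blast
  then have "(\<Sum>i=0..nat n. (\<lambda>_. \<alpha> i) * fps_nth (q ^ i) (nat n))
      = (\<Sum>i\<le>N. (\<lambda>_. \<alpha> i) * fps_nth (q ^ i) (nat n))"
    using n by (intro sum.mono_neutral_left) auto
  then show ?thesis
    using False by (simp add: fls_nth_sum fps_compose_nth flip: fps_to_fls_power)
qed

context vector_field
begin

lemma smooth_ser_cst: "smooth_ser \<A> (cst z)"
  by (rule graded_smooth[OF graded_cst])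

lemma smooth_ser_power: "smooth_ser \<A> s \<Longrightarrow> smooth_ser \<A> (s ^ n)"
  by (induction n) (auto intro: smooth_ser_mult[OF atlas] simp: smooth_ser_cst[of 1, unfolded cst_1])

lemma smooth_ser_sum: "(\<And>i. i \<in> I \<Longrightarrow> smooth_ser \<A> (s i)) \<Longrightarrow> smooth_ser \<A> (\<Sum>i\<in>I. s i)"
  by (simp add: smooth_ser_def fls_nth_sum smooth_fun_sum[OF atlas])

lemma d_ser_sum:
  assumes "\<And>i. i \<in> I \<Longrightarrow> smooth_ser \<A> (s i)"
  shows "d_ser X (\<Sum>i\<in>I. s i) = (\<Sum>i\<in>I. d_ser X (s i))"
  using assms
  by (induction I rule: infinite_finite_induct) (simp_all add: d_ser_0 d_ser_add smooth_ser_sum)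

lemma d_ser_power:
  assumes "smooth_ser \<A> s"
  shows "d_ser X (s ^ Suc n) = of_nat (Suc n) * s ^ n * d_ser X s"
proof (induction n)
  case (Suc n)
  have "d_ser X (s ^ Suc (Suc n)) = d_ser X s * s ^ Suc n + s * d_ser X (s ^ Suc n)"
    using d_ser_mult[OF assms smooth_ser_power[OF assms, of "Suc n"]] by simp
  then show ?case unfolding Suc by (simp add: algebra_simps)
qed simp

text \<open>The chain rule: the last hypothesis makes \<beta> the coefficient sequence of the formal
  derivative of the series with coefficients \<alpha>.\<close>

lemma d_ser_fps_compose:
  fixes q :: "('m \<Rightarrow> complex) fps"
  assumes q: "fps_nth q 0 = 0" "smooth_ser \<A> (fps_to_fls q)"
    and ab: "\<And>i. of_nat (Suc i) * \<alpha> (Suc i) = \<beta> i"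
  shows "d_ser X (fps_to_fls (Abs_fps (\<lambda>n _. \<alpha> n) oo q))
      = fps_to_fls (Abs_fps (\<lambda>n _. \<beta> n) oo q) * d_ser X (fps_to_fls q)"
proof (rule fls_eqI)
  fix n
  let ?Q = "fps_to_fls q"
  let ?N = "nat n"
  have dQ: "fls_nth (d_ser X ?Q) i = 0" if "i < 0" for i
    using that by (simp add: d_ser_nth X_simps zero_fun_def)
  have sm: "smooth_ser \<A> (cst (\<alpha> i) * ?Q ^ i)" for i
    using smooth_ser_mult[OF atlas smooth_ser_cst smooth_ser_power[OF q(2)]] .
  have step: "d_ser X (cst (\<alpha> (Suc i)) * ?Q ^ Suc i) = cst (\<beta> i) * ?Q ^ i * d_ser X ?Q" for i
  proof -
    have \<beta>: "cst (\<beta> i) = cst (\<alpha> (Suc i)) * of_nat (Suc i)"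
      unfolding ab[of i, symmetric] by (rule fls_eqI) (auto simp: fls_of_nat of_nat_fun fun_eq_iff)
    show ?thesis
      unfolding d_ser_mult[OF smooth_ser_cst smooth_ser_power[OF q(2)]] d_ser_cst d_ser_power[OF q(2)] \<beta>
      by (simp only: mult_zero_left add_0_left mult_ac)
  qed
  \<comment> \<open>The partial sum includes the index \<open>Suc ?N\<close>, because
    differentiation lowers the power of \<open>?Q\<close> by one and powers up to \<open>?N\<close>
    must remain.\<close>
  have "fls_nth (d_ser X (fps_to_fls (Abs_fps (\<lambda>n _. \<alpha> n) oo q))) n
      = fls_nth (d_ser X (\<Sum>i\<le>Suc ?N. cst (\<alpha> i) * ?Q ^ i)) n"
    unfolding d_ser_nth by (subst fls_nth_fps_compose[OF q(1), of _ "Suc ?N"]) auto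
  also have "d_ser X (\<Sum>i\<le>Suc ?N. cst (\<alpha> i) * ?Q ^ i)
      = (\<Sum>i\<le>Suc ?N. d_ser X (cst (\<alpha> i) * ?Q ^ i))"
    by (rule d_ser_sum) (rule sm)
  also have "\<dots> = (\<Sum>i\<le>?N. cst (\<beta> i) * ?Q ^ i) * d_ser X ?Q"
    unfolding sum.atMost_Suc_shift step by (simp add: sum_distrib_right d_ser_cst)
  also have "fls_nth \<dots> n = fls_nth (fps_to_fls (Abs_fps (\<lambda>n _. \<beta> n) oo q) * d_ser X ?Q) n"
  proof -
    have neg: "fls_nth (\<Sum>i\<le>?N. cst (\<beta> i) * ?Q ^ i) i = 0" if "i < 0" for i
      using that by (simp add: fls_nth_sum flip: fps_to_fls_power)
    have neg': "fls_nth (fps_to_fls (Abs_fps (\<lambda>n _. \<beta> n) oo q)) i = 0" if "i < 0" for i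
      using that by simp
    have e: "fls_nth (\<Sum>i\<le>?N. cst (\<beta> i) * ?Q ^ i) i
        = fls_nth (fps_to_fls (Abs_fps (\<lambda>n _. \<beta> n) oo q)) i" if "i \<le> n" for i
      using that by (intro fls_nth_fps_compose[OF q(1), symmetric]) simp
    have "fls_nth ((\<Sum>i\<le>?N. cst (\<beta> i) * ?Q ^ i) * d_ser X ?Q) n = (\<Sum>i=0..n - 0.
        fls_nth (\<Sum>i\<le>?N. cst (\<beta> i) * ?Q ^ i) i * fls_nth (d_ser X ?Q) (n - i))"
      by (rule fls_times_nth_bounds) (fact neg dQ)+
    also have "\<dots> = (\<Sum>i=0..n - 0.
        fls_nth (fps_to_fls (Abs_fps (\<lambda>n _. \<beta> n) oo q)) i * fls_nth (d_ser X ?Q) (n - i))"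
      by (rule sum.cong[OF refl]) (simp only: e atLeastAtMost_iff diff_0_right)
    also have "\<dots> = fls_nth (fps_to_fls (Abs_fps (\<lambda>n _. \<beta> n) oo q) * d_ser X ?Q) n"
      by (rule fls_times_nth_bounds[symmetric]) (fact neg' dQ)+
    finally show ?thesis .
  qed
  finally show "fls_nth (d_ser X (fps_to_fls (Abs_fps (\<lambda>n _. \<alpha> n) oo q))) n
      = fls_nth (fps_to_fls (Abs_fps (\<lambda>n _. \<beta> n) oo q) * d_ser X ?Q) n" .
qed

end

lemma graded_power:
  assumes "smooth_atlas \<A>" "graded \<A> 1 s"
  shows "graded \<A> (int n) (s ^ n)"
proof (induction n)
  case 0
  then show ?case using graded_cst[of \<A> 1] by (simp add: cst_1)
next
  case (Suc n)
  then show ?case using graded_mult[OF assms Suc] by simp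
qed

lemma graded_fps_compose:
  fixes q :: "('m::{t2_space,second_countable_topology} \<Rightarrow> complex) fps"
  assumes \<A>: "smooth_atlas \<A>" and q: "fps_nth q 0 = 0" "graded \<A> 1 (fps_to_fls q)"
    and \<alpha>: "\<And>i. \<alpha> i \<noteq> 0 \<Longrightarrow> k \<le> int i \<and> even (int i - k)"
  shows "graded \<A> k (fps_to_fls (Abs_fps (\<lambda>n _. \<alpha> n) oo q))"
proof -
  have g: "graded \<A> k (cst (\<alpha> i) * fps_to_fls q ^ i)" for i
  proof (cases "\<alpha> i = 0")
    case True
    then show ?thesis by (simp add: cst_0 graded_0)
  next
    case False
    show ?thesis
      using graded_mult'[OF \<A> graded_cst graded_power[OF \<A> q(2)]] \<alpha>[OF False] by simp
  qed
  have s: "graded \<A> k (\<Sum>i\<le>N. cst (\<alpha> i) * fps_to_fls q ^ i)" for N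
  proof (induction N)
    case 0
    then show ?case using g[of 0] by simp
  next
    case (Suc N)
    then show ?case unfolding sum.atMost_Suc by (intro graded_add[OF \<A>] g)
  qed
  show ?thesis
    unfolding graded_def smooth_ser_def
  proof (intro conjI allI)
    fix n
    have e: "fls_nth (fps_to_fls (Abs_fps (\<lambda>n _. \<alpha> n) oo q)) n
        = fls_nth (\<Sum>i\<le>nat n. cst (\<alpha> i) * fps_to_fls q ^ i) n"
      by (rule fls_nth_fps_compose[OF q(1)]) simp
    show "smooth_fun \<A> (fls_nth (fps_to_fls (Abs_fps (\<lambda>n _. \<alpha> n) oo q)) n)"
      unfolding e using s by (simp add: graded_def smooth_ser_def)
    show "fls_nth (fps_to_fls (Abs_fps (\<lambda>n _. \<alpha> n) oo q)) n \<noteq> 0 \<longrightarrow> k \<le> n \<and> even (n - k)"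
      unfolding e using s by (simp add: graded_def)
  qed
qed

lemma graded_odd_fps:
  assumes "\<And>n. smooth_fun \<A> (fps_nth p n)" "\<And>n. even n \<Longrightarrow> fps_nth p n = 0"
  shows "graded \<A> 1 (fps_to_fls p)"
  unfolding graded_def smooth_ser_def
proof (intro conjI allI impI)
  fix n
  show "smooth_fun \<A> (fls_nth (fps_to_fls p) n)" using assms(1) by simp
  assume "fls_nth (fps_to_fls p) n \<noteq> 0"
  then have "0 \<le> n" "odd (nat n)" using assms(2) by (auto split: if_splits)
  then show "1 \<le> n" "even (n - 1)" by (auto simp: even_nat_iff elim: oddE)
qed

lemma fps_to_fls_X_times: "fps_to_fls (fps_X * p) = lam 1 * fps_to_fls p"
  by (simp add: fls_times_fps_to_fls fls_X_conv_shift_1)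

context
  fixes \<A> :: "('m::{t2_space,second_countable_topology}, 'e::euclidean_space) chart set"
    and p :: "('m \<Rightarrow> complex) fps"
  assumes \<A>: "smooth_atlas \<A>"
    and p: "\<And>n. smooth_fun \<A> (fps_nth p n)" "\<And>n. odd n \<Longrightarrow> fps_nth p n = 0"
begin

lemma graded_even_fps: "graded \<A> 0 (fps_to_fls p)"
  using p by (auto simp: graded_def smooth_ser_def even_nat_iff)

lemma graded_lam_fps: "graded \<A> 1 (fps_to_fls (fps_X * p))"
  unfolding fps_to_fls_X_times using graded_mult[OF \<A> graded_lam graded_even_fps, of 1] by simp

lemma graded_cosh_lam: "graded \<A> 0 (cosh_lam p)"
  and graded_sinh_lam: "graded \<A> 1 (sinh_lam p)"
  unfolding cosh_lam_def sinh_lam_def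
  by (rule graded_fps_compose[OF \<A> _ graded_lam_fps]; auto split: if_splits elim: oddE)+

lemma d_ser_cosh_sinh_lam:
  assumes "vfield \<A> X"
  shows "d_ser X (cosh_lam p) = sinh_lam p * lam 1 * d_ser X (fps_to_fls p)"
    "d_ser X (sinh_lam p) = cosh_lam p * lam 1 * d_ser X (fps_to_fls p)"
proof -
  interpret vector_field \<A> X by unfold_locales fact+
  have d: "d_ser X (fps_to_fls (fps_X * p)) = lam 1 * d_ser X (fps_to_fls p)"
    unfolding fps_to_fls_X_times
    by (simp add: d_ser_mult[OF graded_smooth[OF graded_lam] graded_smooth[OF graded_even_fps]] d_ser_lam)
  have f: "of_nat (Suc i) * (1 / fact (Suc i)) = (1 / fact i :: complex)" for i
    by (simp add: fact_Suc del: of_nat_Suc)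
  show "d_ser X (cosh_lam p) = sinh_lam p * lam 1 * d_ser X (fps_to_fls p)"
    "d_ser X (sinh_lam p) = cosh_lam p * lam 1 * d_ser X (fps_to_fls p)"
    unfolding cosh_lam_def sinh_lam_def mult.assoc d[symmetric]
    by (rule d_ser_fps_compose[OF _ graded_smooth[OF graded_lam_fps]]; use f in auto)+
qed

end

section \<open>Eigenvectors of the adjoint action\<close>

lemma mat2_nth [simp]:
  "mat2 p q r s $ 1 $ 1 = p" "mat2 p q r s $ 1 $ 2 = q"
  "mat2 p q r s $ 2 $ 1 = r" "mat2 p q r s $ 2 $ 2 = s"
  by (simp_all add: mat2_def)

lemma scale_mat_nth [simp]: "scale_mat k A $ i $ j = k * A $ i $ j"
  by (simp add: scale_mat_def)

lemma commut_nth: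
  "commut A B $ i $ j = A $ i $ 1 * B $ 1 $ j + A $ i $ 2 * B $ 2 $ j
     - (B $ i $ 1 * A $ 1 $ j + B $ i $ 2 * A $ 2 $ j)"
  by (simp add: commut_def matrix_matrix_mult_def sum_2)

lemma mat_eq_iff_2:
  "A = B \<longleftrightarrow> A $ 1 $ 1 = B $ 1 $ 1 \<and> A $ 1 $ 2 = B $ 1 $ 2 \<and> A $ 2 $ 1 = B $ 2 $ 1 \<and> A $ 2 $ 2 = B $ 2 $ 2"
  for A B :: "'a ^ 2 ^ 2"
  by (auto simp: vec_eq_iff forall_2)

lemma trace_2: "trace A = A $ 1 $ 1 + A $ 2 $ 2" for A :: "'a::comm_semiring_1 ^ 2 ^ 2"
  by (simp add: trace_def sum_2)

text \<open>After sorting, products are nested to the right and a square appears as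
  \<open>x * (x * z)\<close>; this form of the relation still applies there.\<close>

lemma square_rewrite: "x * x = y \<Longrightarrow> x * (x * z) = y * z" for x :: "'a::comm_ring_1"
  by (simp flip: mult.assoc)

text \<open>The eigenvector of \<open>ad Y\<close>, with \<open>Y\<close> as in \<open>Y_mat\<close>, for the eigenvalue \<open>-4ngl\<close>.\<close>

definition eigenmatrix :: "'a::comm_ring_1 \<Rightarrow> 'a \<Rightarrow> 'a \<Rightarrow> 'a \<Rightarrow> 'a \<Rightarrow> 'a \<Rightarrow> 'a \<Rightarrow> 'a ^ 2 ^ 2" where
  "eigenmatrix a b c g l i n = mat2
     (- 2 * b * c) ((- 2 * n * g * l - i * a) * c)
     ((2 * n * g * l - i * a) * b) (2 * b * c)"

context
  fixes a b c g l i :: "'a::comm_ring_1"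
  assumes i: "i * i = -1" and a: "a * a = 4 * (b * c) - 4 * (g * (g * (l * l)))"
begin

private lemmas rels = i a i[THEN square_rewrite] a[THEN square_rewrite]

lemma eigenmatrix_commut:
  assumes n: "n * n = 1"
  shows "commut (mat2 (- i * a) (2 * c) (2 * b) (i * a)) (eigenmatrix a b c g l i n)
    + scale_mat (4 * n * g * l) (eigenmatrix a b c g l i n) = 0"
  unfolding mat_eq_iff_2 eigenmatrix_def
  by (simp add: commut_nth) (simp add: algebra_simps rels n n[THEN square_rewrite])

text \<open>Under the trace form \<open>Y\<close> pairs with itself to \<open>8 g^2 l^2\<close> and
  \<open>M 1\<close> with \<open>M (-1)\<close> to \<open>16 g^2 l^2 b c\<close>, while all other
  pairings among the three vanish. This is the resulting expansion with denominators cleared, so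
  that it makes sense in a commutative ring.\<close>

lemma eigenmatrix_expansion:
  fixes Q :: "'a ^ 2 ^ 2"
  assumes Q: "trace Q = 0"
  defines "Y \<equiv> mat2 (- i * a) (2 * c) (2 * b) (i * a)" and "M \<equiv> eigenmatrix a b c g l i"
  shows "scale_mat (16 * (g * (g * (l * l))) * b * c) Q
    = scale_mat (2 * b * c * trace (Q ** Y)) Y
      + scale_mat (trace (Q ** M 1)) (M (-1)) + scale_mat (trace (Q ** M (-1))) (M 1)"
proof -
  have q: "Q $ 2 $ 2 = - Q $ 1 $ 1"
    using Q by (simp add: trace_2 eq_neg_iff_add_eq_0 add.commute)
  show ?thesis
    unfolding mat_eq_iff_2 M_def eigenmatrix_def Y_def
    by (simp add: trace_2 matrix_matrix_mult_def sum_2 q) (simp add: algebra_simps rels)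
qed

text \<open>The primed variables are the derivatives of the unprimed ones, and \<open>F\<close> is the connection matrix.\<close>

lemma eigenmatrix_parallel:
  fixes F :: "'a ^ 2 ^ 2"
  assumes n: "n * n = 1" and k: "4 * k * k * b * c = 1"
    and a': "i * a' = 2 * (F $ 1 $ 2 * b - c * F $ 2 $ 1)"
    and b': "b' = (F $ 1 $ 1 - F $ 2 $ 2) * b + i * a * F $ 2 $ 1"
    and c': "c' = - (F $ 1 $ 1 - F $ 2 $ 2) * c - i * a * F $ 1 $ 2"
    and p': "b * c * p' = g * (b * F $ 1 $ 2 + c * F $ 2 $ 1)"
    and k': "2 * b * c * k' = - k * (b' * c + b * c')"
    and e': "e' = n * l * p' * e"
  shows "scale_mat (k' * e + k * e') (eigenmatrix a b c g l i n)
    + scale_mat (k * e) (mat2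
        (- 2 * (b' * c + b * c')) (- (i * a') * c + (- 2 * n * g * l - i * a) * c')
        (- (i * a') * b + (2 * n * g * l - i * a) * b') (2 * (b' * c + b * c')))
    + scale_mat (k * e) (commut F (eigenmatrix a b c g l i n)) = 0"
proof -
  define f f' where f: "f = F $ 1 $ 2" and f': "f' = F $ 2 $ 1"
  \<comment> \<open>The derivative of \<open>b * c\<close>, in which the diagonal entries of
    \<open>F\<close> cancel.\<close>
  define w where "w = b' * c + b * c'"
  have w: "w = i * a * (c * f' - b * f)"
    by (simp add: w_def b' c' f f' algebra_simps)
  \<comment> \<open>Multiplication by \<open>2 * b * c\<close> eliminates the derivatives of
    \<open>k\<close> and \<open>p\<close> from all four entries alike. It can be undone, since by
    \<open>k\<close> the inverse of this factor is \<open>2 * k * k\<close>.\<close>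
  have core: "(k' * e + k * e') * m + (k * e) * m' + (k * e) * m'' = 0"
    if "(2 * n * g * l * (b * f + c * f') - w) * m + 2 * b * c * (m' + m'') = 0" for m m' m''
  proof -
    let ?T = "(k' * e + k * e') * m + (k * e) * m' + (k * e) * m''"
    have "2 * b * c * ?T
        = e * m * (2 * b * c * k') + 2 * k * n * l * e * m * (b * c * p') + 2 * b * c * k * e * (m' + m'')"
      by (simp add: e' algebra_simps)
    also have "\<dots> = k * e * ((2 * n * g * l * (b * f + c * f') - w) * m + 2 * b * c * (m' + m''))"
      unfolding k' p' by (simp add: w_def f f' algebra_simps)
    also have "\<dots> = 0" by (simp add: that)
    finally have "2 * b * c * ?T = 0" .
    moreover have "?T = 2 * k * k * (2 * b * c * ?T)"
    proof -
      have "2 * k * k * (2 * b * c * ?T) = (4 * k * k * b * c) * ?T" by (simp add: mult_ac)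
      then show ?thesis by (simp add: k)
    qed
    ultimately show ?thesis by simp
  qed
  note rs = rels n n[THEN square_rewrite]
  show ?thesis
    unfolding mat_eq_iff_2 plus_vec_def vec_lambda_beta scale_mat_nth zero_vec_def
  proof (intro conjI core)
    show "(2 * n * g * l * (b * f + c * f') - w) * eigenmatrix a b c g l i n $ 1 $ 1
      + 2 * b * c * (mat2
        (- 2 * (b' * c + b * c')) (- (i * a') * c + (- 2 * n * g * l - i * a) * c')
        (- (i * a') * b + (2 * n * g * l - i * a) * b') (2 * (b' * c + b * c')) $ 1 $ 1
      + commut F (eigenmatrix a b c g l i n) $ 1 $ 1) = 0"
      unfolding w_def[symmetric] commut_nth eigenmatrix_def mat2_nth f[symmetric] f'[symmetric] w
      by (simp add: algebra_simps rs)
    show "(2 * n * g * l * (b * f + c * f') - w) * eigenmatrix a b c g l i n $ 2 $ 2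
      + 2 * b * c * (mat2
        (- 2 * (b' * c + b * c')) (- (i * a') * c + (- 2 * n * g * l - i * a) * c')
        (- (i * a') * b + (2 * n * g * l - i * a) * b') (2 * (b' * c + b * c')) $ 2 $ 2
      + commut F (eigenmatrix a b c g l i n) $ 2 $ 2) = 0"
      unfolding w_def[symmetric] commut_nth eigenmatrix_def mat2_nth f[symmetric] f'[symmetric] w
      by (simp add: algebra_simps rs)
    show "(2 * n * g * l * (b * f + c * f') - w) * eigenmatrix a b c g l i n $ 1 $ 2
      + 2 * b * c * (mat2
        (- 2 * (b' * c + b * c')) (- (i * a') * c + (- 2 * n * g * l - i * a) * c')
        (- (i * a') * b + (2 * n * g * l - i * a) * b') (2 * (b' * c + b * c')) $ 1 $ 2
      + commut F (eigenmatrix a b c g l i n) $ 1 $ 2) = 0"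
      unfolding w_def[symmetric] commut_nth eigenmatrix_def mat2_nth w a' c' f[symmetric] f'[symmetric]
      by (simp add: algebra_simps rs)
    show "(2 * n * g * l * (b * f + c * f') - w) * eigenmatrix a b c g l i n $ 2 $ 1
      + 2 * b * c * (mat2
        (- 2 * (b' * c + b * c')) (- (i * a') * c + (- 2 * n * g * l - i * a) * c')
        (- (i * a') * b + (2 * n * g * l - i * a) * b') (2 * (b' * c + b * c')) $ 2 $ 1
      + commut F (eigenmatrix a b c g l i n) $ 2 $ 1) = 0"
      unfolding w_def[symmetric] commut_nth eigenmatrix_def mat2_nth w a' b' f[symmetric] f'[symmetric]
      by (simp add: algebra_simps rs)
  qed
qed

end

section \<open>Weights of formal expressions\<close>

lemma lookup_emb_mult: "Poly_Mapping.lookup (emb k * F) n = k * Poly_Mapping.lookup F n"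
proof -
  have "Poly_Mapping.lookup (emb k * F) n = (k * Poly_Mapping.lookup F n when Poly_Mapping.lookup F n \<noteq> 0)"
    unfolding emb_def mult_map_scale_conv_mult[symmetric] by transfer simp
  then show ?thesis by (simp add: when_def)
qed

lemma lookup_mult_emb: "Poly_Mapping.lookup (F * emb k) n = Poly_Mapping.lookup F n * k"
  by (simp add: mult.commute[of F] mult.commute[of _ k] lookup_emb_mult)

lemma lookup_emb: "Poly_Mapping.lookup (emb k) n = (if n = 0 then k else 0)"
  by (simp add: emb_def lookup_single)

lemma lookup_cosh_t: "Poly_Mapping.lookup cosh_t n = (if n = 1 \<or> n = -1 then cst (1/2) else 0)"
  by (auto simp: cosh_t_def lookup_add lookup_single)

lemma lookup_sinh_t:
  "Poly_Mapping.lookup sinh_t n = (if n = 1 then cst (1/2) else if n = -1 then - cst (1/2) else 0)"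
  by (auto simp: sinh_t_def lookup_minus lookup_single)

definition coeff_mat :: "int \<Rightarrow> 'm fmat \<Rightarrow> 'm lmat" where
  "coeff_mat n P = map_matrix (\<lambda>F. Poly_Mapping.lookup F n) P"

lemma coeff_mat_nth [simp]: "coeff_mat n P $ i $ j = Poly_Mapping.lookup (P $ i $ j) n"
  by (simp add: coeff_mat_def)

lemma of_int_fun_apply: "(of_int n :: 'a \<Rightarrow> 'b::comm_ring_1) x = of_int n"
  by (cases n rule: int_diff_cases) simp

lemma const_ser_nth [simp]: "fls_nth (const_ser u) n = (\<lambda>_. fls_nth u n)"
  unfolding const_ser_def
  by (rule nth_Abs_fls_lower_bound[of "fls_subdegree u"]) (auto simp: zero_fun_def)

lemma coeff_mat_eqI: "(\<And>n. coeff_mat n P = coeff_mat n Q) \<Longrightarrow> P = Q"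
  unfolding vec_eq_iff coeff_mat_nth by (blast intro: poly_mapping_eqI)

definition half :: "'m lser" where "half = cst (1/2)"

lemma two_half: "2 * (half :: 'm lser) = 1" and half_two: "half * (2 :: 'm lser) = 1"
  unfolding half_def cst_numeral[symmetric] cst_mult[symmetric] by (simp_all add: cst_1)

section \<open>Consequences of the hierarchy equations\<close>

locale cmc =
  fixes H :: "('m::{t2_space,second_countable_topology}, 'e::euclidean_space) cmc"
  assumes H: "truncated_cmc_hierarchy H"
begin

abbreviation "\<A> \<equiv> atlas H"
abbreviation "\<g> \<equiv> cst (sgam H) :: 'm lser"
abbreviation "\<l> \<equiv> lam 1 :: 'm lser"
abbreviation "\<i>' \<equiv> cst \<i> :: 'm lser"
abbreviation "a \<equiv> a_ser H"
abbreviation "b \<equiv> b_ser H"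
abbreviation "c \<equiv> c_ser H"

lemma
  shows atlas: "smooth_atlas \<A>"
    and connected: "connected (UNIV :: 'm set)"
    and gam_nz: "gam H \<noteq> 0" and sgam: "sgam H * sgam H = gam H"
    and smooth_tim: "\<And>m. m \<le> level H \<Longrightarrow> smooth_fun \<A> (tim H m)"
    and coframe: "coframe H"
    and smooth_coef: "\<And>n. smooth_fun \<A> (acoef H n)" "\<And>n. smooth_fun \<A> (bcoef H n)"
      "\<And>n. smooth_fun \<A> (ccoef H n)"
    and det_Y: "det (Y_mat H) = cst (- 4 * gam H) * lam 2"
    and parallel_Y: "\<And>X. vfield \<A> X \<Longrightarrow>
      map_matrix (d_ser X) (Y_mat H) + commut (phi H X) (Y_mat H) = 0"
  using H by (auto simp: truncated_cmc_hierarchy_def power2_eq_square simply_connected_UNIV_imp_connected)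

lemma bcoef_ccoef_0: "bcoef H 0 * ccoef H 0 = (\<lambda>_. gam H)"
proof (rule ext)
  fix x
  have "\<forall>x. h2 H x \<noteq> 0" "\<forall>x. (sh2 H x)\<^sup>2 = h2 H x"
    "\<forall>x. bcoef H 0 x = - \<i> * gam H / sh2 H x \<and> ccoef H 0 x = \<i> * sh2 H x"
    using H by (auto simp: truncated_cmc_hierarchy_def)
  moreover from this have "sh2 H x \<noteq> 0" by (metis power_zero_numeral)
  ultimately show "(bcoef H 0 * ccoef H 0) x = gam H" by (simp add: algebra_simps)
qed

lemma i_square: "\<i>' * \<i>' = - 1"
  by (simp only: cst_mult[symmetric]) (simp add: cst_1 cst_uminus)

lemma g_square: "\<g> * \<g> = cst (gam H)"
  by (simp only: cst_mult[symmetric] sgam)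

lemma lam_mult: "(lam j :: 'm lser) * lam k = lam (j + k)"
  by (rule fls_X_intpow_times_fls_X_intpow)

lemma a_square: "a * a = 4 * (b * c) - 4 * (\<g> * (\<g> * (\<l> * \<l>)))"
proof -
  have "(\<i>' * a) * (\<i>' * a) = (\<i>' * \<i>') * (a * a)" by (simp only: mult_ac)
  then have "det (Y_mat H) = a * a - 4 * (b * c)"
    unfolding i_square by (simp add: det_2 Y_mat_def cst_uminus)
  moreover have "cst (- 4 * gam H) * lam 2 = - 4 * (\<g> * (\<g> * (\<l> * \<l>)))"
  proof -
    have "\<g> * (\<g> * (\<l> * \<l>)) = (\<g> * \<g>) * (\<l> * \<l>)" by (simp only: mult.assoc)
    also have "\<dots> = cst (gam H) * lam 2" by (simp only: g_square lam_mult) simp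
    finally show ?thesis by (simp add: cst_mult cst_uminus cst_numeral mult.assoc del: fls_const_mult_const)
  qed
  ultimately show ?thesis using det_Y by (simp add: algebra_simps)
qed

lemma graded_a_0: "graded \<A> 0 a"
  unfolding a_ser_def by (rule graded_even_fps[OF atlas]) (auto simp: smooth_coef)

lemma graded_b: "graded \<A> 1 b" and graded_c: "graded \<A> 1 c"
  unfolding b_ser_def c_ser_def by (rule graded_odd_fps; auto simp: smooth_coef)+

lemma bc_lead: "fls_nth (b * c) 2 = (\<lambda>_. gam H)"
  by (subst fls_times_nth_bounds[of 1 _ 1])
    (simp_all add: graded_nth_below[OF graded_b] graded_nth_below[OF graded_c] bcoef_ccoef_0,
     simp add: b_ser_def c_ser_def bcoef_ccoef_0)

lemma graded_bc: "graded \<A> 2 (b * c)"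
  using graded_mult[OF atlas graded_b graded_c] by simp

text \<open>By the determinant relation the square of \<open>a\<close> starts at \<lambda>^2, as
  \<open>b * c\<close> does. So the constant coefficient of \<open>a\<close> has square zero, and
  evenness leaves exponents from 2 on.\<close>

lemma graded_a: "graded \<A> 2 a"
proof -
  have "graded \<A> (0 + (0 + (0 + (1 + 1)))) (4 * (\<g> * (\<g> * (\<l> * \<l>))))" "graded \<A> (0 + 2) (4 * (b * c))"
    by (rule graded_mult[OF atlas] graded_numeral graded_cst graded_lam graded_bc)+
  then have "graded \<A> 2 (4 * (b * c) - 4 * (\<g> * (\<g> * (\<l> * \<l>))))"
    by (simp only: add_0 one_add_one graded_diff[OF atlas])
  then have "fls_nth (a * a) 0 = 0" unfolding a_square by (rule graded_nth_below) simp
  moreover have "fls_nth (a * a) 0 = fls_nth a 0 * fls_nth a 0"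
    by (subst fls_times_nth_bounds[of 0 _ 0]) (simp_all add: graded_nth_below[OF graded_a_0])
  ultimately have a0: "fls_nth a 0 = 0" by (metis fun_mult_self_eq_0)
  have "2 \<le> n \<and> even (n - 2)" if "fls_nth a n \<noteq> 0" for n
  proof -
    have "0 \<le> n" "even n" "n \<noteq> 0" using that graded_a_0 a0 by (auto simp: graded_def)
    then show ?thesis by presburger
  qed
  then show ?thesis using graded_a_0 by (simp add: graded_def)
qed

section \<open>The form dE/E of the formal exponential and its lowest term\<close>

definition d\<theta> :: "'m vfield \<Rightarrow> 'm lser" where
  "d\<theta> X = d_ser X (cst (4 * sgam H) * lam 1 * t_frak H)"

lemma vector_fieldI: "vfield \<A> X \<Longrightarrow> vector_field \<A> X"
  by (simp add: vector_field_def atlas)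

lemma d\<theta>_eq: assumes "vfield \<A> X" shows "d\<theta> X = 4 * \<g> * \<l> * alpha H X"
proof -
  interpret vector_field \<A> X using assms by (rule vector_fieldI)
  have s: "smooth_ser \<A> (lam (- (2 * int m + 2)) * fls_const (tim H m))" if "m \<le> level H" for m
    using that
    by (intro smooth_ser_mult[OF atlas graded_smooth[OF graded_lam] graded_smooth[OF graded_const]] smooth_tim)
  have "d_ser X (\<Sum>m\<le>level H. lam (- (2 * int m + 2)) * fls_const (tim H m))
      = (\<Sum>m\<le>level H. d_ser X (lam (- (2 * int m + 2)) * fls_const (tim H m)))"
    by (rule d_ser_sum) (rule s, simp)
  also have "\<dots> = (\<Sum>m\<le>level H. lam (- (2 * int m + 2)) * fls_const (d_fun X (tim H m)))"
  proof (rule sum.cong[OF refl])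
    fix m assume "m \<in> {..level H}"
    then have "smooth_ser \<A> (fls_const (tim H m))"
      using graded_smooth[OF graded_const[OF smooth_tim]] by simp
    then show "d_ser X (lam (- (2 * int m + 2)) * fls_const (tim H m))
        = lam (- (2 * int m + 2)) * fls_const (d_fun X (tim H m))"
      by (simp only: d_ser_mult[OF graded_smooth[OF graded_lam]] d_ser_lam d_ser_fls_const mult_zero_left add_0_left)
  qed
  finally have t: "d_ser X (t_frak H) = alpha H X"
    unfolding t_frak_def alpha_def
    by (subst d_ser_mult[OF smooth_ser_cst smooth_ser_sum])
      (rule s, simp, simp only: d_ser_cst mult_zero_left add_0_left)
  have st: "smooth_ser \<A> (t_frak H)"
    unfolding t_frak_def by (intro smooth_ser_mult[OF atlas smooth_ser_cst] smooth_ser_sum) (rule s, simp)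
  have "smooth_ser \<A> (cst (4 * sgam H) * lam 1)"
    by (intro smooth_ser_mult[OF atlas smooth_ser_cst] graded_smooth[OF graded_lam])
  then have "d\<theta> X = d_ser X (cst (4 * sgam H) * lam 1) * t_frak H + cst (4 * sgam H) * lam 1 * alpha H X"
    unfolding d\<theta>_def by (simp only: d_ser_mult[OF _ st] t)
  also have "d_ser X (cst (4 * sgam H) * lam 1) = 0"
    by (simp only: d_ser_mult[OF smooth_ser_cst graded_smooth[OF graded_lam]] d_ser_cst d_ser_lam
        mult_zero_left mult_zero_right add_0_left)
  finally show ?thesis by (simp add: cst_mult cst_numeral del: fls_const_mult_const)
qed

lemma nth_alpha: "fls_nth (alpha H X) j
    = (\<lambda>_. 1 / (2 * \<i>)) * (\<Sum>m\<le>level H. if j = - (2 * int m + 2) then d_fun X (tim H m) else 0)"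
proof -
  have "fls_nth (lam (- (2 * int m + 2)) * fls_const f) j = (if j = - (2 * int m + 2) then f else 0)"
    for m and f :: "'m \<Rightarrow> complex"
    unfolding fls_X_intpow_times_conv_shift by auto
  then show ?thesis
    unfolding alpha_def fls_mult_const_nth fls_nth_sum by simp
qed

lemma nth_d\<theta>: assumes "vfield \<A> X"
  shows "fls_nth (d\<theta> X) j = (\<lambda>_. 4 * sgam H) * fls_nth (alpha H X) (j - 1)"
proof -
  have "d\<theta> X = cst (4 * sgam H) * (lam 1 * alpha H X)"
    by (simp add: d\<theta>_eq[OF assms] cst_mult cst_numeral mult.assoc del: fls_const_mult_const)
  then show ?thesis
    by (simp only: fls_mult_const_nth fls_X_intpow_times_conv_shift) simp
qed

text \<open>If dt_N vanished at \<open>x\<close>, the coefficient 1 on dt_N and 0 on all other forms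
  would violate the independence in \<open>coframe\<close>.\<close>

lemma dt_nonzero: obtains v where "v \<in> tangent_space \<A> x" "v (tim H (level H)) \<noteq> 0"
proof -
  let ?u = "\<lambda>m. if m = level H then 1 else 0 :: complex"
  have "\<forall>u w. \<forall>s::complex.
        (\<forall>v\<in>tangent_space (atlas H) x.
           (\<Sum>m\<le>level H. u m * v (tim H m)) + (\<Sum>m\<le>level H. w m * v (\<lambda>y. cnj (tim H m y)))
             + s * of_real (rho H x v) = 0)
        \<longrightarrow> (\<forall>m\<le>level H. u m = 0 \<and> w m = 0) \<and> s = 0"
    using coframe unfolding coframe_def by blast
  note indep = this[THEN spec, THEN spec, THEN spec, THEN mp, of ?u "\<lambda>_. 0" 0]
  have "\<not> (\<forall>v\<in>tangent_space \<A> x. (\<Sum>m\<le>level H. ?u m * v (tim H m)) = 0)"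
  proof
    assume "\<forall>v\<in>tangent_space \<A> x. (\<Sum>m\<le>level H. ?u m * v (tim H m)) = 0"
    then have u: "\<forall>m\<le>level H. ?u m = 0" using indep by simp
    show False using u[rule_format, of "level H"] by simp
  qed
  moreover have "(\<Sum>m\<le>level H. ?u m * v (tim H m)) = v (tim H (level H))" for v
    by (simp add: if_distrib[of "\<lambda>z. z * _"] cong: if_cong)
  ultimately show ?thesis using that by auto
qed

text \<open>The lowest term of \<open>d\<theta>\<close> is a nonzero multiple of \<open>\<lambda>\<^sup>-\<^sup>2\<^sup>N\<^sup>-\<^sup>1 dt\<^sub>N\<close>, whereas
  differentiation does not lower the order in \<open>\<lambda>\<close>.\<close>

lemma weighted_eq_0:
  assumes \<tau>: "\<And>X. vfield \<A> X \<Longrightarrow> d_ser X \<tau> + of_int n * d\<theta> X * \<tau> = 0" and n: "n \<noteq> 0"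
  shows "\<tau> = 0"
proof (rule ccontr)
  assume "\<tau> \<noteq> 0"
  let ?k = "fls_subdegree \<tau>" and ?N = "level H"
  \<comment> \<open>The lowest possible exponent of \<open>d\<theta> X\<close>: the factor \<lambda>
    times the power \<open>- (2 * N + 2)\<close> that accompanies dt_N.\<close>
  let ?e = "- (2 * int ?N + 1)"
  \<comment> \<open>Since the coefficient functions have zero divisors, the comparison is made at
    one point where the lowest coefficient of \<tau> does not vanish, with \<open>X\<close> chosen
    to be nonzero on t_N there.\<close>
  obtain x where x: "fls_nth \<tau> ?k x \<noteq> 0"
    using nth_fls_subdegree_nonzero[OF \<open>\<tau> \<noteq> 0\<close>] by (auto simp: fun_eq_iff)
  obtain v where v: "v \<in> tangent_space \<A> x" "v (tim H ?N) \<noteq> 0" by (rule dt_nonzero)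
  obtain X where Xv: "vfield \<A> X" "X x = v" using v(1) by (rule vfield_through)
  interpret vector_field \<A> X using Xv(1) by (rule vector_fieldI)
  have low: "fls_nth (d\<theta> X) j = 0" if "j < ?e" for j
    using that by (auto simp: nth_d\<theta>[OF Xv(1)] nth_alpha intro!: sum.neutral)
  have "(\<Sum>m\<le>?N. if ?e - 1 = - (2 * int m + 2) then d_fun X (tim H m) else 0)
      = (\<Sum>m\<le>?N. if m = ?N then d_fun X (tim H m) else 0)"
    by (rule sum.cong) auto
  then have lead: "fls_nth (d\<theta> X) ?e = (\<lambda>y. 4 * sgam H / (2 * \<i>)) * d_fun X (tim H ?N)"
    by (simp add: nth_d\<theta>[OF Xv(1)] nth_alpha fun_eq_iff)
  have "fls_nth (d\<theta> X * \<tau>) (?e + ?k) = fls_nth (d\<theta> X) ?e * fls_nth \<tau> ?k"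
    by (subst fls_times_nth_bounds[of ?e _ ?k]) (use low in auto)
  \<comment> \<open>\<open>?e\<close> is negative, so this exponent lies below the order of
    \<tau>.\<close>
  moreover have "fls_nth (d_ser X \<tau>) (?e + ?k) = 0"
    by (simp add: d_ser_nth X_simps zero_fun_def)
  moreover have "fls_nth (d_ser X \<tau>) (?e + ?k) + of_int n * fls_nth (d\<theta> X * \<tau>) (?e + ?k) = 0"
    using arg_cong[OF \<tau>[OF Xv(1)], of "\<lambda>s. fls_nth s (?e + ?k)"]
    by (simp only: fls_plus_nth mult.assoc fls_mult_of_int_nth fls_zero_nth)
  ultimately have "of_int n * (fls_nth (d\<theta> X) ?e * fls_nth \<tau> ?k) = 0"
    by simp
  then have "of_int n * (4 * sgam H / (2 * \<i>) * X x (tim H ?N) * fls_nth \<tau> ?k x) = 0"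
    unfolding lead by (drule_tac fun_cong[of _ _ x]) (simp add: d_fun_def of_int_fun_apply)
  then show False
    using n x v(2) Xv(2) gam_nz sgam by auto
qed

text \<open>Connectedness of \<open>M\<close> makes every coefficient constant, and the lower bound
  on the exponents of \<tau> makes these constants a Laurent series.\<close>

lemma const_if_d_ser_eq_0:
  assumes s: "smooth_ser \<A> \<tau>" and \<tau>: "\<And>X. vfield \<A> X \<Longrightarrow> d_ser X \<tau> = 0"
  shows "\<exists>u. \<tau> = const_ser u"
proof -
  have "\<exists>z. fls_nth \<tau> n = (\<lambda>_. z)" for n
  proof (rule constant_if_tangent_vectors_vanish[OF atlas connected])
    show "smooth_fun \<A> (fls_nth \<tau> n)" using s by (simp add: smooth_ser_def)
    fix x v assume v: "v \<in> tangent_space \<A> x"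
    obtain X where Xv: "vfield \<A> X" "X x = v" using v by (rule vfield_through)
    interpret vector_field \<A> X using Xv(1) by (rule vector_fieldI)
    show "v (fls_nth \<tau> n) = 0"
      using arg_cong[OF \<tau>[OF Xv(1)], of "\<lambda>s. fls_nth s n x"] Xv(2) by (simp add: d_ser_nth)
  qed
  then obtain z where z: "\<And>n. fls_nth \<tau> n = (\<lambda>_. z n)" by metis
  have "z n = 0" if "n < fls_subdegree \<tau>" for n
    using z[of n] that by (simp add: fun_eq_iff)
  then have "fls_nth (Abs_fls z) n = z n" for n
    by (intro nth_Abs_fls_lower_bound) auto
  then show ?thesis
    using z by (intro exI[of _ "Abs_fls z"] fls_eqI) simp
qed

end

section \<open>Closure of smooth series and differentiation of constants\<close>

lemma smooth_ser_add:
  assumes "smooth_atlas \<A>" "smooth_ser \<A> s" "smooth_ser \<A> t"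
  shows "smooth_ser \<A> (s + t)"
  using assms by (simp add: smooth_ser_def smooth_fun_add)

lemma smooth_ser_uminus:
  assumes "smooth_atlas \<A>" "smooth_ser \<A> s"
  shows "smooth_ser \<A> (- s)"
  using assms by (simp add: smooth_ser_def smooth_fun_uminus)

lemma smooth_ser_diff:
  assumes "smooth_atlas \<A>" "smooth_ser \<A> s" "smooth_ser \<A> t"
  shows "smooth_ser \<A> (s - t)"
  using smooth_ser_add[OF assms(1,2) smooth_ser_uminus[OF assms(1,3)]] by simp

lemma of_int_eq_cst: "of_int n = cst (of_int n)"
  by (rule fls_eqI) (auto simp: fls_of_int_nth fun_eq_iff of_int_fun_apply)

lemma smooth_ser_const_ser: "smooth_ser \<A> (const_ser u)"
  by (simp add: smooth_ser_def smooth_fun_const)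

lemma (in vector_field) d_ser_const_ser: "d_ser X (const_ser u) = 0"
  by (rule fls_eqI) (simp add: d_ser_nth X_simps zero_fun_def)

lemma (in vector_field) d_ser_uminus: "smooth_ser \<A> s \<Longrightarrow> d_ser X (- s) = - d_ser X s"
  using d_ser_mult[OF smooth_ser_cst, of s "-1"] by (simp add: d_ser_cst) (simp add: cst_uminus cst_1)

lemma (in vector_field) d_ser_diff:
  "smooth_ser \<A> s \<Longrightarrow> smooth_ser \<A> t \<Longrightarrow> d_ser X (s - t) = d_ser X s - d_ser X t"
  using d_ser_add[OF _ smooth_ser_uminus[OF atlas], of s t] by (simp add: d_ser_uminus)

lemma (in vector_field) d_ser_of_int: "d_ser X (of_int n) = 0"
  unfolding of_int_eq_cst by (rule d_ser_cst)

lemma smooth_ser_of_int: "smooth_ser \<A> (of_int n)"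
  unfolding of_int_eq_cst by (rule graded_smooth[OF graded_cst])

context cmc
begin

text \<open>The equation satisfied by the coefficient of \<open>E\<^sup>n\<close> of a formal Killing field.\<close>

definition weight :: "int \<Rightarrow> 'm lmat \<Rightarrow> bool" where
  "weight n A \<longleftrightarrow> (\<forall>X. vfield \<A> X \<longrightarrow>
     map_matrix (d_ser X) A + commut (phi H X) A + scale_mat (of_int n * d\<theta> X) A = 0)"

definition smooth_mat :: "'m lmat \<Rightarrow> bool" where
  "smooth_mat A \<longleftrightarrow> (\<forall>i j. smooth_ser \<A> (A $ i $ j))"

lemmas smooth_a = graded_smooth[OF graded_a] and smooth_b = graded_smooth[OF graded_b]
  and smooth_c = graded_smooth[OF graded_c] and smooth_lam = graded_smooth[OF graded_lam]
  and smooth_cst = graded_smooth[OF graded_cst] and smooth_numeral = graded_smooth[OF graded_numeral]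

lemmas smooth_intros = smooth_ser_mult[OF atlas] smooth_ser_add[OF atlas] smooth_ser_diff[OF atlas]
  smooth_ser_uminus[OF atlas] smooth_ser_of_int smooth_ser_const_ser
  smooth_a smooth_b smooth_c smooth_lam smooth_cst smooth_numeral

lemma Y_mat_eq: "Y_mat H = mat2 (- \<i>' * a) (2 * c) (2 * b) (\<i>' * a)"
  by (simp add: Y_mat_def cst_uminus)

lemma smooth_Y: "smooth_mat (Y_mat H)"
  by (simp add: smooth_mat_def forall_2 Y_mat_eq smooth_intros)

lemma weight_Y: "weight 0 (Y_mat H)"
  using parallel_Y by (simp add: weight_def mat_eq_iff_2)

text \<open>The connection drops out because the trace of
  \<open>[\<phi>, A] B + A [\<phi>, B] = [\<phi>, A B]\<close> is zero, and the exponents of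
  \<open>E\<close> add.\<close>

lemma trace_weight:
  assumes A: "weight m A" "smooth_mat A" and B: "weight n B" "smooth_mat B" and X: "vfield \<A> X"
  shows "d_ser X (trace (A ** B)) + of_int (m + n) * d\<theta> X * trace (A ** B) = 0"
proof -
  interpret vector_field \<A> X using X by (rule vector_fieldI)
  have dA: "d_ser X (A $ i $ j) = - (commut (phi H X) A $ i $ j) - of_int m * d\<theta> X * A $ i $ j"
    and dB: "d_ser X (B $ i $ j) = - (commut (phi H X) B $ i $ j) - of_int n * d\<theta> X * B $ i $ j" for i j
    using A(1) B(1) X unfolding weight_def vec_eq_iff
    by (simp_all add: eq_diff_eq eq_neg_iff_add_eq_0 add_ac)
  show ?thesis
    using A(2) B(2)
    by (simp add: smooth_mat_def trace_2 matrix_matrix_mult_def sum_2 d_ser_add d_ser_mult smooth_intros dA dB)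
      (simp add: commut_nth algebra_simps)
qed

lemma weight_scale:
  assumes "weight n A" "smooth_mat A" and k: "smooth_ser \<A> k" "\<And>X. vfield \<A> X \<Longrightarrow> d_ser X k = 0"
  shows "weight n (scale_mat k A)"
  unfolding weight_def
proof (intro allI impI)
  fix X assume X: "vfield \<A> X"
  interpret vector_field \<A> X using X by (rule vector_fieldI)
  have "scale_mat k (map_matrix (d_ser X) A + commut (phi H X) A + scale_mat (of_int n * d\<theta> X) A) = 0"
    using assms(1) X by (simp add: weight_def mat_eq_iff_2)
  then show "map_matrix (d_ser X) (scale_mat k A) + commut (phi H X) (scale_mat k A)
      + scale_mat (of_int n * d\<theta> X) (scale_mat k A) = 0"
    using assms(2)
    by (simp add: mat_eq_iff_2 smooth_mat_def d_ser_mult k X commut_nth)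
      (simp add: algebra_simps)
qed

lemma weight_0: "weight n 0"
proof -
  have "d_ser X 0 = 0" if "vfield \<A> X" for X
    using vector_field.d_ser_0[OF vector_fieldI[OF that]] .
  then show ?thesis by (simp add: weight_def mat_eq_iff_2 commut_nth)
qed

lemma coeff_mat_d_formal:
  assumes "vfield \<A> X"
  shows "coeff_mat n (map_matrix (d_formal H X) P)
    = map_matrix (d_ser X) (coeff_mat n P) + scale_mat (of_int n * d\<theta> X) (coeff_mat n P)"
proof -
  have "Poly_Mapping.lookup (d_formal H X F) n
      = d_ser X (Poly_Mapping.lookup F n) + of_int n * d\<theta> X * Poly_Mapping.lookup F n" for F
    unfolding d_formal_def d\<theta>_def[symmetric] lookup_mapp
    by (simp add: when_def in_keys_iff vector_field.d_ser_0[OF vector_fieldI[OF assms]])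
  then show ?thesis by (simp add: vec_eq_iff)
qed

lemma coeff_mat_commut: "coeff_mat n (commut (emb_mat A) P) = commut A (coeff_mat n P)"
  by (simp add: vec_eq_iff commut_nth emb_mat_def lookup_add lookup_minus lookup_emb_mult lookup_mult_emb)

text \<open>The differential and the bracket with \<phi> both preserve the power of
  \<open>E\<close>, and distinct powers of \<open>E\<close> are independent, so the equation splits
  into one equation per exponent.\<close>

lemma formal_killing_iff_weight: "formal_killing H P \<longleftrightarrow> (\<forall>n. weight n (coeff_mat n P))"
proof -
  have "map_matrix (d_formal H X) P + commut (emb_mat (phi H X)) P = 0 \<longleftrightarrow>
      (\<forall>n. map_matrix (d_ser X) (coeff_mat n P) + commut (phi H X) (coeff_mat n P)
        + scale_mat (of_int n * d\<theta> X) (coeff_mat n P) = 0)" if X: "vfield \<A> X" for X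
  proof -
    let ?Z = "map_matrix (d_formal H X) P + commut (emb_mat (phi H X)) P"
    have "coeff_mat n (A + B) = coeff_mat n A + coeff_mat n B" for n and A B :: "'m fmat"
      by (simp add: vec_eq_iff lookup_add)
    then have "coeff_mat n ?Z = map_matrix (d_ser X) (coeff_mat n P) + commut (phi H X) (coeff_mat n P)
        + scale_mat (of_int n * d\<theta> X) (coeff_mat n P)" for n
      by (simp add: coeff_mat_d_formal[OF X] coeff_mat_commut add_ac)
    moreover have "?Z = 0 \<longleftrightarrow> (\<forall>n. coeff_mat n ?Z = 0)"
    proof
      assume "\<forall>n. coeff_mat n ?Z = 0"
      then show "?Z = 0" by (intro coeff_mat_eqI) (simp add: vec_eq_iff)
    qed (simp add: vec_eq_iff)
    ultimately show ?thesis by simp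
  qed
  then show ?thesis unfolding formal_killing_def weight_def by blast
qed

end

section \<open>The dressed frame\<close>

locale dressed = cmc H
  for H :: "('m::{t2_space,second_countable_topology}, 'e::euclidean_space) cmc" +
  fixes r \<kappa> :: "'m lser" and p :: "('m \<Rightarrow> complex) fps"
  assumes dressing: "dressing H r \<kappa> p"
begin

abbreviation "C \<equiv> cosh_lam p"
abbreviation "S \<equiv> sinh_lam p"

lemma
  shows smooth_r: "smooth_ser \<A> r" and r_square: "r * r = b * c" and kr: "\<kappa> * (2 * r) = 1"
    and p_smooth: "\<And>n. smooth_fun \<A> (fps_nth p n)" and p_even: "\<And>n. odd n \<Longrightarrow> fps_nth p n = 0"
    and dp: "\<And>X. vfield \<A> X \<Longrightarrow> (b * c) * d_ser X (fps_to_fls p)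
        = \<g> * (b * phi_check H X $ 1 $ 2 + c * phi_check H X $ 2 $ 1)"
  using dressing by (auto simp: dressing_def power2_eq_square)

lemma graded_r: "graded \<A> 1 r" and r_lead: "fls_nth r 1 * fls_nth r 1 = (\<lambda>_. gam H)"
  using graded_sqrt[OF smooth_r, of "gam H"] graded_bc bc_lead gam_nz
  by (simp_all add: power2_eq_square r_square)

lemma graded_\<kappa>: "graded \<A> (-1) \<kappa>"
proof -
  have "graded \<A> (-1) (2 * \<kappa>)"
  proof (rule graded_inverse[OF atlas graded_r])
    show "2 * \<kappa> * r = 1" using kr by (simp add: mult_ac)
    \<comment> \<open>By \<open>r_lead\<close> the leading coefficient of \<open>r\<close> squares
      to \<gamma>, so its inverse is itself divided by \<gamma>.\<close>
    show "smooth_fun \<A> ((\<lambda>_. 1 / gam H) * fls_nth r 1)"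
      using smooth_r by (intro smooth_fun_mult[OF atlas] smooth_fun_const) (simp add: smooth_ser_def)
    have "fls_nth r 1 * ((\<lambda>_. 1 / gam H) * fls_nth r 1) = (\<lambda>_. 1 / gam H) * (fls_nth r 1 * fls_nth r 1)"
      by (simp only: mult_ac)
    also have "\<dots> = 1" unfolding r_lead using gam_nz by (simp add: fun_eq_iff)
    finally show "fls_nth r 1 * ((\<lambda>_. 1 / gam H) * fls_nth r 1) = 1" .
  qed
  then have "graded \<A> (-1) (half * (2 * \<kappa>))"
    unfolding half_def using graded_mult[OF atlas graded_cst] by fastforce
  then show ?thesis by (simp add: half_two flip: mult.assoc)
qed

lemma graded_C: "graded \<A> 0 C" and graded_S: "graded \<A> 1 S"
  by (rule graded_cosh_lam[OF atlas] graded_sinh_lam[OF atlas]; simp add: p_smooth p_even)+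

lemmas smooth_dressed = smooth_intros smooth_r graded_smooth[OF graded_\<kappa>]
  graded_smooth[OF graded_C] graded_smooth[OF graded_S]

lemma kkbc: "4 * \<kappa> * \<kappa> * b * c = 1"
proof -
  have "4 * \<kappa> * \<kappa> * b * c = 4 * \<kappa> * \<kappa> * (r * r)" by (simp only: r_square mult.assoc)
  also have "\<dots> = (\<kappa> * (2 * r)) * (\<kappa> * (2 * r))" by simp
  finally show ?thesis by (simp only: kr mult_1)
qed

lemma CS: "C * C - S * S = 1"
  by (rule cosh_lam_sinh_lam)

text \<open>For \<open>n = 1\<close> and \<open>n = -1\<close> the factor
  \<open>C + of_int n * S\<close> is the exponential of n \<lambda> p. Together with \<kappa> it
  rescales the eigenvector of \<open>ad Y\<close> to a parallel one.\<close>

definition W :: "int \<Rightarrow> 'm lmat" where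
  "W n = scale_mat (\<kappa> * (C + of_int n * S)) (eigenmatrix a b c \<g> \<l> \<i>' (of_int n))"

lemma smooth_W: "smooth_mat (W n)"
  by (simp add: W_def smooth_mat_def forall_2 eigenmatrix_def smooth_dressed)


lemma weight_W:
  assumes n: "n * n = 1"
  shows "weight n (W n)"
  unfolding weight_def
proof (intro allI impI)
  fix X assume X: "vfield \<A> X"
  interpret vector_field \<A> X using X by (rule vector_fieldI)
  let ?D = "d_ser X" and ?F = "phi_check H X" and ?\<alpha> = "alpha H X"
  let ?n = "of_int n :: 'm lser" and ?e = "C + of_int n * S"
  let ?M = "eigenmatrix a b c \<g> \<l> \<i>' ?n"
  have n': "?n * ?n = 1" using n by (metis of_int_1 of_int_mult)
  have phi: "phi H X = ?F + scale_mat ?\<alpha> (Y_mat H)" by (simp add: phi_check_def)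
  \<comment> \<open>\<open>Y_mat H\<close> commutes with its own multiple by \<alpha>, so it is
    parallel for the dressed connection too. Its entries then give the derivatives of
    \<open>a\<close>, \<open>c\<close> and \<open>b\<close>.\<close>
  have "map_matrix ?D (Y_mat H) + commut ?F (Y_mat H) = 0"
  proof -
    have "commut (phi H X) (Y_mat H) = commut ?F (Y_mat H)"
      unfolding phi mat_eq_iff_2 by (simp add: commut_nth) (simp add: algebra_simps)
    with parallel_Y[OF X] show ?thesis by simp
  qed
  then have Z: "?D (Y_mat H $ i $ j) + commut ?F (Y_mat H) $ i $ j = 0" for i j
    by (simp add: vec_eq_iff)
  have DY: "?D (Y_mat H $ 1 $ 1) = - (\<i>' * ?D a)" "?D (Y_mat H $ 1 $ 2) = 2 * ?D c"
      "?D (Y_mat H $ 2 $ 1) = 2 * ?D b"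
    by (simp_all add: Y_mat_eq d_ser_mult d_ser_uminus smooth_intros d_ser_cst d_ser_numeral)
  have Y: "- (\<i>' * ?D a) + (2 * (?F $ 1 $ 2 * b) - 2 * (c * ?F $ 2 $ 1)) = 0"
    unfolding Z[of 1 1, symmetric] DY by (simp add: commut_nth Y_mat_eq algebra_simps)
  have Y2: "2 * (?D c + (?F $ 1 $ 1 - ?F $ 2 $ 2) * c + \<i>' * a * ?F $ 1 $ 2) = 0"
    unfolding Z[of 1 2, symmetric] DY by (simp add: commut_nth Y_mat_eq algebra_simps)
  have Y3: "2 * (?D b - (?F $ 1 $ 1 - ?F $ 2 $ 2) * b - \<i>' * a * ?F $ 2 $ 1) = 0"
    unfolding Z[of 2 1, symmetric] DY by (simp add: commut_nth Y_mat_eq algebra_simps)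
  have halve: "z = 0" if "2 * z = 0" for z :: "'m lser"
  proof -
    have "z = half * (2 * z)" by (simp add: half_two flip: mult.assoc)
    with that show ?thesis by simp
  qed
  have a': "\<i>' * ?D a = 2 * (?F $ 1 $ 2 * b - c * ?F $ 2 $ 1)"
    using Y by (simp add: algebra_simps)
  have c': "?D c = - (?F $ 1 $ 1 - ?F $ 2 $ 2) * c - \<i>' * a * ?F $ 1 $ 2"
  proof -
    have "?D c - (- (?F $ 1 $ 1 - ?F $ 2 $ 2) * c - \<i>' * a * ?F $ 1 $ 2) = 0"
      unfolding halve[OF Y2, symmetric] by (simp add: algebra_simps)
    then show ?thesis by (simp only: right_minus_eq)
  qed
  have b': "?D b = (?F $ 1 $ 1 - ?F $ 2 $ 2) * b + \<i>' * a * ?F $ 2 $ 1"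
  proof -
    have "?D b - ((?F $ 1 $ 1 - ?F $ 2 $ 2) * b + \<i>' * a * ?F $ 2 $ 1) = 0"
      unfolding halve[OF Y3, symmetric] by (simp add: algebra_simps)
    then show ?thesis by (simp only: right_minus_eq)
  qed
  \<comment> \<open>Both \<open>\<kappa> * (2 * r) = 1\<close> and \<open>r * r = b * c\<close> are
    differentiated, and the derivative of \<open>r\<close> is eliminated.\<close>
  have k': "2 * b * c * ?D \<kappa> = - \<kappa> * (?D b * c + b * ?D c)"
  proof -
    have "?D (\<kappa> * (2 * r)) = 0" unfolding kr using d_ser_cst[of 1] by (simp add: cst_1)
    then have 1: "2 * r * ?D \<kappa> = - (2 * \<kappa> * ?D r)"
      by (simp add: d_ser_mult smooth_dressed d_ser_numeral eq_neg_iff_add_eq_0 algebra_simps)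
    have 2: "2 * r * ?D r = ?D b * c + b * ?D c"
      using arg_cong[OF r_square, of ?D] by (simp add: d_ser_mult smooth_dressed mult.assoc)
    have "2 * b * c * ?D \<kappa> = (b * c) * (2 * ?D \<kappa>)" by (simp only: mult_ac)
    also have "\<dots> = r * (2 * r * ?D \<kappa>)" unfolding r_square[symmetric] by (simp only: mult_ac)
    also have "\<dots> = - \<kappa> * (2 * r * ?D r)" unfolding 1 by simp
    finally show ?thesis unfolding 2 .
  qed
  \<comment> \<open>Writing \<open>S\<close> as \<open>n * n * S\<close> exhibits the common factor
    \<open>n\<close> and restores the exponential \<open>?e\<close>.\<close>
  have e': "?D ?e = ?n * \<l> * ?D (fps_to_fls p) * ?e"
  proof -
    note d = d_ser_cosh_sinh_lam[OF atlas p_smooth p_even X]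
    have "?D ?e = S * \<l> * ?D (fps_to_fls p) + ?n * (C * \<l> * ?D (fps_to_fls p))"
      by (simp add: d_ser_add d_ser_mult smooth_dressed d_ser_of_int d)
    also have "\<dots> = (?n * ?n) * S * \<l> * ?D (fps_to_fls p) + ?n * (C * \<l> * ?D (fps_to_fls p))"
      by (simp add: n')
    finally show ?thesis by (simp add: algebra_simps)
  qed
  note par = eigenmatrix_parallel[OF i_square a_square n' kkbc a' b' c' dp[OF X] k' e']
  let ?M' = "mat2 (- 2 * (?D b * c + b * ?D c)) (- (\<i>' * ?D a) * c + (- 2 * ?n * \<g> * \<l> - \<i>' * a) * ?D c)
        (- (\<i>' * ?D a) * b + (2 * ?n * \<g> * \<l> - \<i>' * a) * ?D b) (2 * (?D b * c + b * ?D c))"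
  have M': "map_matrix ?D ?M = ?M'"
    by (simp add: mat_eq_iff_2 eigenmatrix_def d_ser_mult d_ser_add d_ser_diff d_ser_uminus d_ser_numeral
        d_ser_cst d_ser_lam d_ser_of_int smooth_dressed)
  have sM: "\<forall>i j. smooth_ser \<A> (?M $ i $ j)"
    by (simp add: forall_2 eigenmatrix_def smooth_dressed)
  have "map_matrix ?D (W n) = scale_mat (?D \<kappa> * ?e + \<kappa> * ?D ?e) ?M + scale_mat (\<kappa> * ?e) ?M'"
    unfolding M'[symmetric]
    by (simp add: vec_eq_iff W_def d_ser_mult sM smooth_dressed)
  \<comment> \<open>The summand of \<phi> that is \<alpha> times \<open>Y_mat H\<close> acts on the
    eigenvector through its eigenvalue, and the term with \<open>d\<theta>\<close> cancels exactly
    this.\<close>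
  moreover have "commut (phi H X) (W n) + scale_mat (?n * d\<theta> X) (W n)
      = scale_mat (\<kappa> * ?e) (commut ?F ?M)"
  proof -
    have "commut (phi H X) (W n) + scale_mat (?n * d\<theta> X) (W n)
      = scale_mat (\<kappa> * ?e) (commut ?F ?M)
        + scale_mat (\<kappa> * ?e * ?\<alpha>) (commut (Y_mat H) ?M + scale_mat (4 * ?n * \<g> * \<l>) ?M)"
      unfolding phi W_def d\<theta>_eq[OF X] vec_eq_iff by (simp add: commut_nth algebra_simps)
    then show ?thesis
      unfolding Y_mat_eq eigenmatrix_commut[OF i_square a_square n'] by (simp add: vec_eq_iff)
  qed
  ultimately show "map_matrix ?D (W n) + commut (phi H X) (W n) + scale_mat (?n * d\<theta> X) (W n) = 0"
    using par by (simp add: add.assoc)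
qed

lemma W_eq:
  assumes n: "n * n = 1"
  shows "W n = V_minus H \<kappa> p - scale_mat (of_int n * \<l>) (V_plus H \<kappa> p)"
proof -
  have n': "of_int n * of_int n = (1 :: 'm lser)" using n by (metis of_int_1 of_int_mult)
  \<comment> \<open>\<open>fls_shift 1 1\<close> is the form that \<open>lam (-1)\<close> takes
    under simplification.\<close>
  have "fls_shift 1 1 * \<l> = 1" using lam_mult[of "-1" 1] by simp
  then have l: "fls_shift 1 1 * \<l> = 1" "fls_shift 1 1 * (\<l> * z) = z"
    "fls_shift 1 1 * (2 * \<l>) = 2" "fls_shift 1 1 * (2 * (\<l> * z)) = 2 * z" for z
    by (simp_all flip: mult.assoc) (simp_all add: mult.commute[of _ 2] mult.assoc)
  note rs = n' square_rewrite[OF n'] l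
  show ?thesis
    unfolding W_def V_minus_def V_plus_def Let_def mat_eq_iff_2 eigenmatrix_def
    by (simp del: fls_const_mult_const) (simp add: algebra_simps rs)
qed

end

section \<open>Formal Killing fields\<close>

text \<open>An odd off-diagonal entry without negative powers starts at \<lambda>, whence grade 1
  there.\<close>

lemma loop_algebra_ge_0_iff:
  "Q \<in> loop_algebra_ge \<A> 0 \<longleftrightarrow> graded \<A> 0 (Q $ 1 $ 1) \<and> graded \<A> 0 (Q $ 2 $ 2) \<and>
     graded \<A> 1 (Q $ 1 $ 2) \<and> graded \<A> 1 (Q $ 2 $ 1) \<and> trace Q = 0"
proof -
  have e: "graded \<A> 0 s \<longleftrightarrow> smooth_ser \<A> s \<and> (\<forall>n. odd n \<longrightarrow> fls_nth s n = 0) \<and> (\<forall>n<0. fls_nth s n = 0)" for s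
    unfolding graded_def by (auto simp: not_less[symmetric])
  have o: "graded \<A> 1 s \<longleftrightarrow> smooth_ser \<A> s \<and> (\<forall>n. even n \<longrightarrow> fls_nth s n = 0) \<and> (\<forall>n<0. fls_nth s n = 0)" for s
  proof -
    have "1 \<le> n \<and> even (n - 1) \<longleftrightarrow> odd n \<and> \<not> n < 0" for n :: int by presburger
    then show ?thesis unfolding graded_def by auto
  qed
  show ?thesis
    unfolding e o loop_algebra_ge_def loop_algebra_def mem_Collect_eq forall_2 by (simp; blast)
qed

lemma const_ser_0: "const_ser 0 = 0" and const_ser_1: "const_ser 1 = 1"
  and const_ser_add: "const_ser (u + v) = const_ser u + const_ser v"
  and const_ser_diff: "const_ser (u - v) = const_ser u - const_ser v"
  by (rule fls_eqI; auto simp: fun_eq_iff)+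

lemma const_ser_X_mult: "const_ser (fls_X * u) = lam 1 * const_ser u"
  by (rule fls_eqI) (simp add: fls_X_conv_shift_1 fls_X_intpow_times_conv_shift)

lemma graded_0_const_ser_iff: "graded \<A> 0 (const_ser u) \<longleftrightarrow> u \<in> even_power_series"
  by (auto simp: graded_def smooth_ser_const_ser even_power_series_def fun_eq_iff)

context dressed
begin

section \<open>Killing combinations and their gradings\<close>

lemmas graded_leaves = graded_numeral graded_cst graded_lam graded_a graded_b graded_c
  graded_\<kappa> graded_C graded_S

lemma lam_inverse:
  "fls_shift 1 1 * \<l> = 1" "fls_shift 1 1 * (\<l> * z) = z"
  "\<l> * fls_shift 1 1 = 1" "\<l> * (fls_shift 1 1 * z) = z"
proof -
  show 1: "fls_shift 1 1 * \<l> = 1" using lam_mult[of "-1" 1] by simp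
  then show 2: "\<l> * fls_shift 1 1 = 1" by (simp add: mult.commute)
  show "fls_shift 1 1 * (\<l> * z) = z" "\<l> * (fls_shift 1 1 * z) = z"
    using 1 2 by (simp_all flip: mult.assoc)
qed

text \<open>By \<open>W_eq\<close>, at exponent \<open>n\<close> with \<open>n * n = 1\<close> the
  field \<open>P_minus\<close> contributes \<open>W n / 2\<close>, and \<open>P_plus\<close>
  contributes \<open>W n\<close> times \<open>- n / (2 \<lambda>)\<close>.\<close>

lemma coeff_mat_killing_comb:
  "coeff_mat n (killing_comb H \<kappa> p u0 up um) =
    (if n = 0 then scale_mat (const_ser u0) (Y_mat H)
     else if n * n = 1
     then scale_mat (half * (const_ser um - of_int n * (const_ser up * lam (-1)))) (W n)
     else 0)"
proof -
  have L: "Poly_Mapping.lookup (killing_comb H \<kappa> p u0 up um $ i $ j) n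
    = const_ser u0 * (if n = 0 then Y_mat H $ i $ j else 0)
      + const_ser up * (Poly_Mapping.lookup cosh_t n * V_plus H \<kappa> p $ i $ j
          - Poly_Mapping.lookup sinh_t n * lam (-1) * V_minus H \<kappa> p $ i $ j)
      + const_ser um * (Poly_Mapping.lookup cosh_t n * V_minus H \<kappa> p $ i $ j
          - Poly_Mapping.lookup sinh_t n * \<l> * V_plus H \<kappa> p $ i $ j)" for i j n
    by (simp add: killing_comb_def P_plus_def P_minus_def emb_mat_def lookup_add lookup_emb_mult
        lookup_mult_emb lookup_emb lookup_minus)
  consider "n = 0" | "n = 1" | "n = -1" | "n \<noteq> 0" "n * n \<noteq> 1" "n \<noteq> 1" "n \<noteq> -1"
    by (cases "n = 0 \<or> n = 1 \<or> n = -1") (auto simp: zmult_eq_1_iff)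
  then show ?thesis
  proof cases
    case 1
    then show ?thesis by (simp add: vec_eq_iff L lookup_cosh_t lookup_sinh_t)
  next
    case 2
    then show ?thesis
      by (simp add: vec_eq_iff L lookup_cosh_t lookup_sinh_t W_eq flip: half_def)
        (simp add: algebra_simps lam_inverse)
  next
    case 3
    then show ?thesis
      by (simp add: vec_eq_iff L lookup_cosh_t lookup_sinh_t W_eq flip: half_def)
        (simp add: algebra_simps lam_inverse)
  next
    case 4
    then show ?thesis by (simp add: vec_eq_iff L lookup_cosh_t lookup_sinh_t)
  qed
qed

lemma formal_killing_comb: "formal_killing H (killing_comb H \<kappa> p u0 up um)"
  unfolding formal_killing_iff_weight coeff_mat_killing_comb
proof (intro allI)
  fix n :: int
  let ?k = "half * (const_ser um - of_int n * (const_ser up * lam (-1))) :: 'm lser"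
  have "weight n (scale_mat (const_ser u0) (Y_mat H))" if "n = 0"
    unfolding that
    by (rule weight_scale[OF weight_Y smooth_Y smooth_ser_const_ser vector_field.d_ser_const_ser[OF vector_fieldI]])
  moreover have "weight n (scale_mat ?k (W n))" if "n * n = 1"
  proof (rule weight_scale[OF weight_W[OF that] smooth_W])
    show "smooth_ser \<A> ?k" unfolding half_def by (intro smooth_intros)
    fix X assume "vfield \<A> X"
    then interpret vector_field \<A> X by (rule vector_fieldI)
    show "d_ser X ?k = 0"
      unfolding half_def
      by (simp add: d_ser_mult d_ser_diff d_ser_cst d_ser_of_int d_ser_const_ser d_ser_lam smooth_intros
          smooth_lam[where k = "-1", simplified] d_ser_lam[where k = "-1", simplified])
  qed
  ultimately show "weight n (if n = 0 then scale_mat (const_ser u0) (Y_mat H)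
      else if n * n = 1 then scale_mat ?k (W n) else 0)"
    by (simp add: weight_0)
qed

lemma formal_killing_P_plus: "formal_killing H (P_plus H \<kappa> p)"
  and formal_killing_P_minus: "formal_killing H (P_minus H \<kappa> p)"
proof -
  have "P_plus H \<kappa> p = killing_comb H \<kappa> p 0 1 0" "P_minus H \<kappa> p = killing_comb H \<kappa> p 0 0 1"
    by (simp_all add: vec_eq_iff killing_comb_def const_ser_0 const_ser_1 emb_def)
  then show "formal_killing H (P_plus H \<kappa> p)" "formal_killing H (P_minus H \<kappa> p)"
    by (simp_all add: formal_killing_comb)
qed

text \<open>The factor \<kappa> of grade -1 reverses the parities: the diagonal becomes odd and the
  off-diagonal entries even.\<close>

lemma graded_V_plus:
  "graded \<A> 1 (V_plus H \<kappa> p $ 1 $ 1)" "graded \<A> 1 (V_plus H \<kappa> p $ 2 $ 2)"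
  "graded \<A> 0 (V_plus H \<kappa> p $ 1 $ 2)" "graded \<A> 0 (V_plus H \<kappa> p $ 2 $ 1)"
proof -
  have "graded \<A> 2 (2 * S * lam (-1) * b * c)" "graded \<A> 1 (2 * \<g> * C * c)" "graded \<A> 1 (2 * \<g> * C * b)"
    "graded \<A> 1 (\<i>' * S * lam (-1) * a * c)" "graded \<A> 1 (\<i>' * S * lam (-1) * a * b)"
    by - (rule graded_mono, (rule graded_mult[OF atlas] graded_leaves)+, simp, simp)+
  then have "graded \<A> 2 (2 * S * lam (-1) * b * c)" "graded \<A> 2 (- 2 * S * lam (-1) * b * c)"
    "graded \<A> 1 (2 * \<g> * C * c + \<i>' * S * lam (-1) * a * c)"
    "graded \<A> 1 (- 2 * \<g> * C * b + \<i>' * S * lam (-1) * a * b)"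
    using graded_uminus[OF atlas] graded_add[OF atlas] by fastforce+
  from this[THEN graded_mult'[OF atlas graded_\<kappa>]] show
    "graded \<A> 1 (V_plus H \<kappa> p $ 1 $ 1)" "graded \<A> 1 (V_plus H \<kappa> p $ 2 $ 2)"
    "graded \<A> 0 (V_plus H \<kappa> p $ 1 $ 2)" "graded \<A> 0 (V_plus H \<kappa> p $ 2 $ 1)"
    unfolding V_plus_def Let_def scale_mat_nth mat2_nth by simp_all
qed

text \<open>Because \<open>a\<close> starts at \<lambda>^2, the off-diagonal entries have grade 2.
  This leaves room for a scalar factor with a simple pole in \<lambda>.\<close>

lemma graded_V_minus:
  "graded \<A> 1 (V_minus H \<kappa> p $ 1 $ 1)" "graded \<A> 1 (V_minus H \<kappa> p $ 2 $ 2)"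
  "graded \<A> 2 (V_minus H \<kappa> p $ 1 $ 2)" "graded \<A> 2 (V_minus H \<kappa> p $ 2 $ 1)"
proof -
  have "graded \<A> 2 (2 * C * b * c)" "graded \<A> 3 (2 * \<g> * S * \<l> * c)" "graded \<A> 3 (2 * \<g> * S * \<l> * b)"
    "graded \<A> 3 (\<i>' * C * a * c)" "graded \<A> 3 (\<i>' * C * a * b)"
    by - (rule graded_mono, (rule graded_mult[OF atlas] graded_leaves)+, simp, simp)+
  then have "graded \<A> 2 (2 * C * b * c)" "graded \<A> 2 (- 2 * C * b * c)"
    "graded \<A> 3 (- 2 * \<g> * S * \<l> * c - \<i>' * C * a * c)"
    "graded \<A> 3 (2 * \<g> * S * \<l> * b - \<i>' * C * a * b)"
    using graded_uminus[OF atlas] graded_diff[OF atlas] by fastforce+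
  from this[THEN graded_mult'[OF atlas graded_\<kappa>]] show
    "graded \<A> 1 (V_minus H \<kappa> p $ 1 $ 1)" "graded \<A> 1 (V_minus H \<kappa> p $ 2 $ 2)"
    "graded \<A> 2 (V_minus H \<kappa> p $ 1 $ 2)" "graded \<A> 2 (V_minus H \<kappa> p $ 2 $ 1)"
    unfolding V_minus_def Let_def scale_mat_nth mat2_nth by simp_all
qed

lemma trace_V: "trace (V_plus H \<kappa> p) = 0" "trace (V_minus H \<kappa> p) = 0"
  by (simp_all add: trace_2 V_plus_def V_minus_def Let_def)

lemma V_comb_in_loop_algebra:
  assumes s: "graded \<A> 1 s" and t: "graded \<A> m t" "-1 \<le> m" "odd m"
  shows "scale_mat s (V_plus H \<kappa> p) + scale_mat t (V_minus H \<kappa> p) \<in> loop_algebra_ge \<A> 0"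
proof -
  note V = graded_mult'[OF atlas s] graded_mult'[OF atlas t(1)]
  have "graded \<A> 0 (s * V_plus H \<kappa> p $ 1 $ 1)" "graded \<A> 0 (s * V_plus H \<kappa> p $ 2 $ 2)"
    "graded \<A> 1 (s * V_plus H \<kappa> p $ 1 $ 2)" "graded \<A> 1 (s * V_plus H \<kappa> p $ 2 $ 1)"
    by - (rule V(1)[OF graded_V_plus(1)] V(1)[OF graded_V_plus(2)]
        V(1)[OF graded_V_plus(3)] V(1)[OF graded_V_plus(4)], simp, simp)+
  moreover have "graded \<A> 0 (t * V_minus H \<kappa> p $ 1 $ 1)" "graded \<A> 0 (t * V_minus H \<kappa> p $ 2 $ 2)"
    "graded \<A> 1 (t * V_minus H \<kappa> p $ 1 $ 2)" "graded \<A> 1 (t * V_minus H \<kappa> p $ 2 $ 1)"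
    by - (rule V(2)[OF graded_V_minus(1)] V(2)[OF graded_V_minus(2)]
        V(2)[OF graded_V_minus(3)] V(2)[OF graded_V_minus(4)], use t in simp, use t in simp)+
  moreover have "trace (scale_mat s (V_plus H \<kappa> p) + scale_mat t (V_minus H \<kappa> p))
      = s * trace (V_plus H \<kappa> p) + t * trace (V_minus H \<kappa> p)"
    by (simp add: trace_2 algebra_simps)
  ultimately show ?thesis
    unfolding loop_algebra_ge_0_iff by (simp add: graded_add[OF atlas] trace_V)
qed

lemma cosh_sinh_form_killing_comb:
  assumes u: "u0 \<in> even_power_series" "up \<in> even_power_series" "um \<in> even_power_series"
  shows "cosh_sinh_form H (killing_comb H \<kappa> p u0 (fls_X * up) (fls_X * um))"
proof -
  let ?V = "V_plus H \<kappa> p" and ?V' = "V_minus H \<kappa> p"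
  let ?s = "const_ser um :: 'm lser" and ?q = "const_ser up :: 'm lser"
  let ?Q0 = "scale_mat (const_ser u0) (Y_mat H)"
  \<comment> \<open>Collecting \<lambda> \<open>up\<close> \<open>P_plus\<close> + \<lambda>
    \<open>um\<close> \<open>P_minus\<close> by cosh and by \<lambda> sinh. Splitting off \<lambda>
    from the sinh part leaves the factor \<open>lam (-1)\<close> in front of
    \<open>V_minus\<close>.\<close>
  let ?Qp = "scale_mat (\<l> * ?q) ?V + scale_mat (\<l> * ?s) ?V'"
  let ?Qm = "scale_mat (- (\<l> * ?s)) ?V + scale_mat (- (lam (-1) * ?q)) ?V'"
  note g = u[folded graded_0_const_ser_iff[of \<A>]]
  have ql: "graded \<A> 1 (\<l> * ?q)" "graded \<A> 1 (\<l> * ?s)" "graded \<A> 1 (- (\<l> * ?s))"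
    "graded \<A> (-1) (- (lam (-1) * ?q))"
    using graded_mult[OF atlas graded_lam g(2), of 1] graded_mult[OF atlas graded_lam g(3), of 1]
      graded_mult[OF atlas graded_lam g(2), of "-1"] graded_uminus[OF atlas] by auto
  have "graded \<A> 0 (const_ser u0 * Y_mat H $ 1 $ 1)" "graded \<A> 0 (const_ser u0 * Y_mat H $ 2 $ 2)"
    "graded \<A> 1 (const_ser u0 * Y_mat H $ 1 $ 2)" "graded \<A> 1 (const_ser u0 * Y_mat H $ 2 $ 1)"
    unfolding Y_mat_def mat2_nth
    by - (rule graded_mono, (rule graded_mult[OF atlas] graded_leaves g(1))+, simp, simp)+
  then have "?Q0 \<in> loop_algebra_ge \<A> 0"
    unfolding loop_algebra_ge_0_iff by (simp add: trace_2) (simp add: Y_mat_eq)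
  moreover have "?Qp \<in> loop_algebra_ge \<A> 0" "?Qm \<in> loop_algebra_ge \<A> 0"
    using ql by (auto intro!: V_comb_in_loop_algebra)
  moreover have "killing_comb H \<kappa> p u0 (fls_X * up) (fls_X * um)
      = emb_mat ?Q0 + scale_mat cosh_t (emb_mat ?Qp) + scale_mat (sinh_t * emb \<l>) (emb_mat ?Qm)"
  proof (rule coeff_mat_eqI)
    fix n
    show "coeff_mat n (killing_comb H \<kappa> p u0 (fls_X * up) (fls_X * um))
      = coeff_mat n (emb_mat ?Q0 + scale_mat cosh_t (emb_mat ?Qp) + scale_mat (sinh_t * emb \<l>) (emb_mat ?Qm))"
      by (simp add: vec_eq_iff killing_comb_def P_plus_def P_minus_def emb_mat_def lookup_add lookup_emb_mult
        lookup_mult_emb lookup_emb lookup_minus const_ser_X_mult)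
        (simp add: algebra_simps lam_inverse)
  qed
  ultimately show ?thesis unfolding cosh_sinh_form_def by blast
qed


section \<open>Coordinates in the frame Y, W 1, W (-1)\<close>

abbreviation N_inv :: "'m lser" where
  "N_inv \<equiv> cst (1 / (8 * gam H)) * lam (-2)"

lemma N_inv: "N_inv * (8 * (\<g> * (\<g> * (\<l> * \<l>)))) = 1"
proof -
  have "N_inv * (8 * (\<g> * (\<g> * (\<l> * \<l>)))) = cst (1 / (8 * gam H)) * (8 * (\<g> * \<g>)) * (lam (-2) * (\<l> * \<l>))"
    by (simp only: mult_ac)
  also have "\<dots> = cst (1 / (8 * gam H)) * cst (8 * gam H) * lam 0"
    unfolding g_square lam_mult cst_mult cst_numeral by simp
  also have "\<dots> = 1"
    unfolding cst_mult[symmetric] using gam_nz by (simp add: cst_1)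
  finally show ?thesis .
qed

text \<open>\<open>N_inv\<close> inverts 8 \<gamma> \<lambda>^2, the pairing of
  \<open>Y_mat H\<close> with itself. In the pairing of \<open>W 1\<close> with
  \<open>W (-1)\<close> the exponentials cancel and \<open>kkbc\<close> removes
  \<open>b * c\<close>; half of that value remains, hence the factor
  \<open>2 * N_inv\<close>.\<close>

lemma killing_frame_expansion:
  assumes A: "trace A = 0"
  shows "A = scale_mat (N_inv * trace (A ** Y_mat H)) (Y_mat H)
    + scale_mat (2 * N_inv * trace (A ** W 1)) (W (-1)) + scale_mat (2 * N_inv * trace (A ** W (-1))) (W 1)"
proof -
  let ?M = "eigenmatrix a b c \<g> \<l> \<i>'"
  have W: "W 1 = scale_mat (\<kappa> * (C + S)) (?M 1)" "W (-1) = scale_mat (\<kappa> * (C - S)) (?M (-1))"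
    by (simp_all add: W_def)
  have tr: "trace (A ** scale_mat k B) = k * trace (A ** B)" for k B
    by (simp add: trace_2 matrix_matrix_mult_def sum_2 algebra_simps)
  have CS': "(C + S) * (C - S) = 1" using CS by (simp add: algebra_simps)
  have pair: "(\<kappa> * (C + S) * t) * (\<kappa> * (C - S) * m) = \<kappa> * \<kappa> * (t * m)"
    "(\<kappa> * (C - S) * t) * (\<kappa> * (C + S) * m) = \<kappa> * \<kappa> * (t * m)" for t m
  proof -
    have "(\<kappa> * (C + S) * t) * (\<kappa> * (C - S) * m) = ((C + S) * (C - S)) * (\<kappa> * \<kappa> * (t * m))"
      "(\<kappa> * (C - S) * t) * (\<kappa> * (C + S) * m) = ((C + S) * (C - S)) * (\<kappa> * \<kappa> * (t * m))"
      by (simp_all only: mult_ac)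
    then show "(\<kappa> * (C + S) * t) * (\<kappa> * (C - S) * m) = \<kappa> * \<kappa> * (t * m)"
      "(\<kappa> * (C - S) * t) * (\<kappa> * (C + S) * m) = \<kappa> * \<kappa> * (t * m)"
      by (simp_all only: CS' mult_1)
  qed
  have "A $ i $ j = N_inv * trace (A ** Y_mat H) * Y_mat H $ i $ j
    + 2 * N_inv * trace (A ** W 1) * W (-1) $ i $ j + 2 * N_inv * trace (A ** W (-1)) * W 1 $ i $ j" for i j
  proof -
    have "16 * (\<g> * (\<g> * (\<l> * \<l>))) * b * c * A $ i $ j = 2 * b * c * trace (A ** Y_mat H) * Y_mat H $ i $ j
      + trace (A ** ?M 1) * ?M (-1) $ i $ j + trace (A ** ?M (-1)) * ?M 1 $ i $ j"
      using eigenmatrix_expansion[OF i_square a_square A] by (simp add: vec_eq_iff Y_mat_eq)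
    then have e: "2 * N_inv * \<kappa> * \<kappa> * (16 * (\<g> * (\<g> * (\<l> * \<l>))) * b * c * A $ i $ j)
      = 2 * N_inv * \<kappa> * \<kappa> * (2 * b * c * trace (A ** Y_mat H) * Y_mat H $ i $ j
      + trace (A ** ?M 1) * ?M (-1) $ i $ j + trace (A ** ?M (-1)) * ?M 1 $ i $ j)"
      by (simp only:)
    have "A $ i $ j = (N_inv * (8 * (\<g> * (\<g> * (\<l> * \<l>))))) * (4 * \<kappa> * \<kappa> * b * c) * A $ i $ j"
      unfolding N_inv kkbc by simp
    also have "\<dots> = 2 * N_inv * \<kappa> * \<kappa> * (16 * (\<g> * (\<g> * (\<l> * \<l>))) * b * c * A $ i $ j)"
      by (simp add: mult_ac del: fls_const_mult_const)
    also have "\<dots> = (4 * \<kappa> * \<kappa> * b * c) * (N_inv * trace (A ** Y_mat H) * Y_mat H $ i $ j)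
      + 2 * N_inv * (\<kappa> * \<kappa> * (trace (A ** ?M 1) * ?M (-1) $ i $ j))
      + 2 * N_inv * (\<kappa> * \<kappa> * (trace (A ** ?M (-1)) * ?M 1 $ i $ j))"
      unfolding e by (simp add: algebra_simps del: fls_const_mult_const)
    also have "\<dots> = N_inv * trace (A ** Y_mat H) * Y_mat H $ i $ j
      + 2 * N_inv * (trace (A ** W 1) * W (-1) $ i $ j) + 2 * N_inv * (trace (A ** W (-1)) * W 1 $ i $ j)"
      unfolding kkbc W tr scale_mat_nth pair by (simp only: mult_1)
    finally show ?thesis by (simp only: mult.assoc)
  qed
  then show ?thesis by (simp only: vec_eq_iff vector_add_component scale_mat_nth) simp
qed

section \<open>Classification of the coefficients by weight\<close>

lemma trace_weight_eq_0:
  assumes "weight m A" "smooth_mat A" "weight n B" "smooth_mat B" "m + n \<noteq> 0"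
  shows "trace (A ** B) = 0"
  using weighted_eq_0[of "trace (A ** B)" "m + n"] trace_weight[OF assms(1-4)] assms(5) by blast

lemma trace_weight_const:
  assumes A: "weight m A" "smooth_mat A" and B: "weight (- m) B" "smooth_mat B"
    and k: "\<And>X. vfield \<A> X \<Longrightarrow> d_ser X k = 0" "smooth_ser \<A> k"
  shows "\<exists>u. k * trace (A ** B) = const_ser u"
proof (rule const_if_d_ser_eq_0)
  have s: "smooth_ser \<A> (trace (A ** B))"
    using A(2) B(2)
    by (auto simp: trace_2 matrix_matrix_mult_def sum_2 smooth_mat_def intro!: smooth_intros)
  then show "smooth_ser \<A> (k * trace (A ** B))" using k(2) by (intro smooth_intros)
  fix X assume X: "vfield \<A> X"
  interpret vector_field \<A> X using X by (rule vector_fieldI)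
  show "d_ser X (k * trace (A ** B)) = 0"
    using trace_weight[OF A B X] k(1)[OF X] by (simp add: d_ser_mult[OF k(2) s])
qed

lemma N_inv_parallel:
  assumes "vfield \<A> X"
  shows "d_ser X N_inv = 0" "d_ser X (2 * N_inv) = 0"
proof -
  interpret vector_field \<A> X using assms by (rule vector_fieldI)
  show 1: "d_ser X N_inv = 0"
    unfolding d_ser_mult[OF smooth_cst smooth_lam] d_ser_cst d_ser_lam by simp
  have "smooth_ser \<A> N_inv" by (intro smooth_intros)
  then show "d_ser X (2 * N_inv) = 0"
    by (simp only: d_ser_mult[OF smooth_numeral] d_ser_numeral 1 mult_zero_left mult_zero_right add_0_left)
qed

text \<open>The pairings with \<open>W 1\<close> and \<open>W (-1)\<close> have weights 1 and -1 and
  vanish; only the pairing with \<open>Y_mat H\<close> has weight 0.\<close>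

lemma weight_0_classification:
  assumes A: "weight 0 A" "smooth_mat A" "trace A = 0"
  shows "\<exists>u. A = scale_mat (const_ser u) (Y_mat H)"
proof -
  have "trace (A ** W 1) = 0" "trace (A ** W (-1)) = 0"
    by (rule trace_weight_eq_0[OF A(1,2) weight_W smooth_W]; simp)+
  then have "A = scale_mat (N_inv * trace (A ** Y_mat H)) (Y_mat H)"
    using killing_frame_expansion[OF A(3)] by (simp add: vec_eq_iff)
  moreover have "\<exists>u. N_inv * trace (A ** Y_mat H) = const_ser u"
    using weight_Y by (intro trace_weight_const[OF A(1,2)] smooth_Y N_inv_parallel smooth_intros) simp_all
  ultimately show ?thesis by metis
qed

text \<open>The pairings with \<open>Y_mat H\<close> and \<open>W n\<close> have the nonzero weights
  \<open>n\<close> and \<open>2 * n\<close>; only the one with \<open>W (- n)\<close> survives, as a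
  constant.\<close>

lemma weight_unit_classification:
  assumes n: "n * n = 1" and A: "weight n A" "smooth_mat A" "trace A = 0"
  shows "\<exists>u. A = scale_mat (const_ser u) (W n)"
proof -
  have n': "n = 1 \<or> n = -1" using n by (simp add: zmult_eq_1_iff)
  have "trace (A ** Y_mat H) = 0"
    using n' by (intro trace_weight_eq_0[OF A(1,2) weight_Y smooth_Y]) auto
  moreover have "trace (A ** W n) = 0"
    using n' by (intro trace_weight_eq_0[OF A(1,2) weight_W[OF n] smooth_W]) auto
  ultimately have "A = scale_mat (2 * N_inv * trace (A ** W (- n))) (W n)"
    using killing_frame_expansion[OF A(3)] n' by (auto simp: vec_eq_iff)
  moreover have "\<exists>u. 2 * N_inv * trace (A ** W (- n)) = const_ser u"
    using n by (intro trace_weight_const[OF A(1,2)] weight_W smooth_W N_inv_parallel smooth_intros) simp_all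
  ultimately show ?thesis by metis
qed

lemma killing_comb_even_power_series:
  assumes Q: "formal_killing H Q" "cosh_sinh_form H Q"
  obtains u0 up um where "Q = killing_comb H \<kappa> p u0 (fls_X * up) (fls_X * um)"
    "u0 \<in> even_power_series" "up \<in> even_power_series" "um \<in> even_power_series"
proof -
  obtain Q0 Qp Qm where Qs: "Q0 \<in> loop_algebra_ge \<A> 0" "Qp \<in> loop_algebra_ge \<A> 0" "Qm \<in> loop_algebra_ge \<A> 0"
    and Qe: "Q = emb_mat Q0 + scale_mat cosh_t (emb_mat Qp) + scale_mat (sinh_t * emb \<l>) (emb_mat Qm)"
    using Q(2) unfolding cosh_sinh_form_def by blast
  have co: "coeff_mat 0 Q = Q0" "coeff_mat 1 Q = scale_mat half (Qp + scale_mat \<l> Qm)"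
    "coeff_mat (-1) Q = scale_mat half (Qp - scale_mat \<l> Qm)"
    "n \<noteq> 0 \<Longrightarrow> n * n \<noteq> 1 \<Longrightarrow> coeff_mat n Q = 0" for n
    unfolding Qe half_def
    by (auto simp: vec_eq_iff emb_mat_def lookup_add lookup_emb lookup_mult_emb lookup_cosh_t lookup_sinh_t)
      (simp_all add: algebra_simps)
  have wt: "weight n (coeff_mat n Q)" for n
    using Q(1) unfolding formal_killing_iff_weight by blast
  note g = Qs[unfolded loop_algebra_ge_0_iff]
  have "smooth_mat Q0" "smooth_mat Qp" "smooth_mat Qm"
    using g unfolding smooth_mat_def forall_2 by (auto intro: graded_smooth)
  then have sm: "smooth_mat Q0" "smooth_mat (scale_mat half (Qp + scale_mat \<l> Qm))"
    "smooth_mat (scale_mat half (Qp - scale_mat \<l> Qm))"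
    unfolding smooth_mat_def half_def scale_mat_nth vector_add_component vector_minus_component
    by (auto intro!: smooth_intros)
  have tr: "trace (scale_mat half (Qp + scale_mat \<l> Qm)) = half * (trace Qp + \<l> * trace Qm)"
    "trace (scale_mat half (Qp - scale_mat \<l> Qm)) = half * (trace Qp - \<l> * trace Qm)"
    by (simp_all add: trace_2 algebra_simps)
  obtain u0 where u0: "Q0 = scale_mat (const_ser u0) (Y_mat H)"
    using weight_0_classification[of Q0] wt[of 0] sm g unfolding co by blast
  obtain z where z: "scale_mat half (Qp + scale_mat \<l> Qm) = scale_mat (const_ser z) (W 1)"
    using weight_unit_classification[of 1 "scale_mat half (Qp + scale_mat \<l> Qm)"] wt[of 1] sm g tr
    unfolding co by auto
  obtain y where y: "scale_mat half (Qp - scale_mat \<l> Qm) = scale_mat (const_ser y) (W (-1))"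
    using weight_unit_classification[of "-1" "scale_mat half (Qp - scale_mat \<l> Qm)"] wt[of "-1"] sm g tr
    unfolding co by auto
  \<comment> \<open>These solve the equations of \<open>coeff_mat_killing_comb\<close> at the
    exponents 1 and -1: half of \<open>fls_X * um - up\<close> has to be \<open>z\<close>, and half
    of \<open>fls_X * um + up\<close> has to be \<open>y\<close>.\<close>
  define um where "um = fls_shift 1 (y + z)"
  define up where "up = y - z"
  define s :: "'m lser" where "s = const_ser (fls_X * um)"
  define q :: "'m lser" where "q = const_ser (fls_X * up)"
  have um: "fls_X * um = y + z"
    unfolding um_def by (rule fls_eqI) (simp add: fls_X_times_conv_shift)
  have s: "s = const_ser y + const_ser z" by (simp add: s_def um const_ser_add)
  have q: "q = \<l> * (const_ser y - const_ser z)"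
    by (simp add: q_def up_def const_ser_X_mult const_ser_diff)
  have hh: "half + half = (1 :: 'm lser)" by (simp only: mult_2[symmetric] two_half)
  have sum: "Qp $ i $ j = const_ser z * W 1 $ i $ j + const_ser y * W (-1) $ i $ j"
    and diff: "\<l> * Qm $ i $ j = const_ser z * W 1 $ i $ j - const_ser y * W (-1) $ i $ j" for i j
  proof -
    have 1: "half * (Qp $ i $ j + \<l> * Qm $ i $ j) = const_ser z * W 1 $ i $ j"
      "half * (Qp $ i $ j - \<l> * Qm $ i $ j) = const_ser y * W (-1) $ i $ j"
      using z y by (simp_all add: vec_eq_iff)
    have "Qp $ i $ j = (half + half) * Qp $ i $ j" "\<l> * Qm $ i $ j = (half + half) * (\<l> * Qm $ i $ j)"
      by (simp_all add: hh)
    then show "Qp $ i $ j = const_ser z * W 1 $ i $ j + const_ser y * W (-1) $ i $ j"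
      "\<l> * Qm $ i $ j = const_ser z * W 1 $ i $ j - const_ser y * W (-1) $ i $ j"
      unfolding 1[symmetric] by (simp_all add: algebra_simps)
  qed
  \<comment> \<open>The factor \<open>2 * \<kappa>\<close> cancels
    \<open>\<kappa> * (- 2 * b * c)\<close> in the diagonal entries of \<open>W\<close>, up to sign.
    What remains are combinations of \<open>z\<close> and \<open>y\<close> with the two exponentials
    only.\<close>
  define A where "A = 2 * \<kappa> * Qp $ 1 $ 1"
  define B where "B = 2 * \<kappa> * Qm $ 1 $ 1"
  have AB: "graded \<A> (-1) A" "graded \<A> (-1) B"
    unfolding A_def B_def
    using graded_mult[OF atlas graded_mult[OF atlas graded_numeral graded_\<kappa>]] g by fastforce+
  have W11: "W 1 $ 1 $ 1 = \<kappa> * (C + S) * (- 2 * b * c)" "W (-1) $ 1 $ 1 = \<kappa> * (C - S) * (- 2 * b * c)"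
    by (simp_all add: W_def eigenmatrix_def)
  have A: "A = - (const_ser z * (C + S) + const_ser y * (C - S))"
  proof -
    have "A = - (4 * \<kappa> * \<kappa> * b * c) * (const_ser z * (C + S) + const_ser y * (C - S))"
      unfolding A_def sum W11 by (simp add: algebra_simps)
    then show ?thesis unfolding kkbc by simp
  qed
  have B: "\<l> * B = - (const_ser z * (C + S) - const_ser y * (C - S))"
  proof -
    have "\<l> * B = 2 * \<kappa> * (\<l> * Qm $ 1 $ 1)" by (simp add: B_def mult_ac)
    also have "\<dots> = - (4 * \<kappa> * \<kappa> * b * c) * (const_ser z * (C + S) - const_ser y * (C - S))"
      unfolding diff W11 by (simp add: algebra_simps)
    finally show ?thesis unfolding kkbc by simp
  qed
  have CC: "C * C = 1 + S * S" using CS by (simp add: algebra_simps)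
  note CCs = CC CC[THEN square_rewrite]
  \<comment> \<open>The hyperbolic rotation by \<lambda> p, which mixes the constants into
    \<open>A\<close> and \<open>\<l> * B\<close>, is inverted with \<open>CS\<close>.\<close>
  have s_AB: "s = \<l> * B * S - A * C"
    unfolding A B s by (simp add: algebra_simps CCs)
  have q_AB: "q = \<l> * (\<l> * B * C - A * S)"
    unfolding A B q by (simp add: algebra_simps CCs)
  \<comment> \<open>The diagonal alone leaves a possible \<lambda>^(-1) term in \<open>A\<close>.
    The off-diagonal entry of \<open>Qm\<close> excludes it: up to a term of grade 1 it equals
    \<open>2 * \<g> * \<kappa> * c * A\<close>.\<close>
  have A1: "graded \<A> 1 A"
  proof -
    have "\<l> * Qm $ 1 $ 2 = \<kappa> * c * (2 * \<g> * \<l> * A + \<i>' * a * (\<l> * B))"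
      unfolding diff A B by (simp add: W_def eigenmatrix_def) (simp add: algebra_simps)
    also have "\<dots> = \<l> * (\<kappa> * c * (2 * \<g> * A + \<i>' * a * B))" by (simp add: algebra_simps)
    finally have "fls_shift 1 1 * (\<l> * Qm $ 1 $ 2) = fls_shift 1 1 * (\<l> * (\<kappa> * c * (2 * \<g> * A + \<i>' * a * B)))"
      by simp
    then have "2 * \<g> * \<kappa> * c * A = Qm $ 1 $ 2 - \<i>' * \<kappa> * c * a * B"
      unfolding lam_inverse by (simp add: algebra_simps)
    moreover have "graded \<A> 1 (\<i>' * \<kappa> * c * a * B)"
      by (rule graded_mono, (rule graded_mult[OF atlas] graded_leaves AB)+, simp, simp)
    ultimately have "graded \<A> 1 (2 * \<g> * \<kappa> * c * A)"
      using g graded_diff[OF atlas] by simp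
    \<comment> \<open>This is the inverse of \<open>2 * \<g> * \<kappa> * c\<close>, by
      \<open>g_square\<close> and \<open>kkbc\<close>.\<close>
    moreover have "graded \<A> 0 (cst (1 / gam H) * 2 * \<kappa> * b * \<g>)"
      by (rule graded_mono, (rule graded_mult[OF atlas] graded_leaves)+, simp, simp)
    ultimately have "graded \<A> (0 + 1) (cst (1 / gam H) * 2 * \<kappa> * b * \<g> * (2 * \<g> * \<kappa> * c * A))"
      by (intro graded_mult[OF atlas])
    moreover have "cst (1 / gam H) * 2 * \<kappa> * b * \<g> * (2 * \<g> * \<kappa> * c * A)
        = (cst (1 / gam H) * (\<g> * \<g>)) * (4 * \<kappa> * \<kappa> * b * c) * A"
      by (simp add: mult_ac del: fls_const_mult_const)
    moreover have "cst (1 / gam H) * (\<g> * \<g>) = 1"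
      unfolding g_square cst_mult[symmetric] using gam_nz by (simp add: cst_1)
    ultimately show ?thesis by (simp only: kkbc) simp
  qed
  have "graded \<A> 1 (\<l> * B * S)" "graded \<A> 1 (A * C)"
    by - (rule graded_mono, (rule graded_mult[OF atlas] graded_leaves AB A1)+, simp, simp)+
  then have gs: "graded \<A> 1 s" unfolding s_AB by (rule graded_diff[OF atlas])
  have "graded \<A> 1 (\<l> * (\<l> * B * C))" "graded \<A> 1 (\<l> * (A * S))"
    by - (rule graded_mono, (rule graded_mult[OF atlas] graded_leaves AB)+, simp, simp)+
  then have gq: "graded \<A> 1 q" unfolding q_AB right_diff_distrib by (rule graded_diff[OF atlas])
  have shift: "u \<in> even_power_series" if "graded \<A> 1 (const_ser (fls_X * u) :: 'm lser)" for u
  proof -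
    have "graded \<A> (-1 + 1) (lam (-1) * const_ser (fls_X * u))"
      by (rule graded_mult[OF atlas graded_lam that])
    moreover have "lam (-1) * (const_ser (fls_X * u) :: 'm lser) = const_ser u"
      unfolding const_ser_X_mult by (simp add: lam_inverse)
    ultimately show ?thesis by (simp add: graded_0_const_ser_iff)
  qed
  have "up \<in> even_power_series" "um \<in> even_power_series"
    using gs gq unfolding s_def q_def by (auto intro: shift)
  moreover have "u0 \<in> even_power_series"
  proof -
    have "graded \<A> 1 (const_ser u0 * (2 * c))"
      using g(1) unfolding u0 by (simp add: Y_mat_eq)
    \<comment> \<open>By \<open>kkbc\<close> this is the inverse of \<open>2 * c\<close>, so it
      recovers \<open>u0\<close> from an off-diagonal entry of \<open>Q0\<close>.\<close>
    moreover have "graded \<A> (-1) (2 * \<kappa> * \<kappa> * b)"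
      by (rule graded_mono, (rule graded_mult[OF atlas] graded_leaves)+, simp, simp)
    ultimately have "graded \<A> (-1 + 1) (2 * \<kappa> * \<kappa> * b * (const_ser u0 * (2 * c)))"
      by (intro graded_mult[OF atlas])
    moreover have "2 * \<kappa> * \<kappa> * b * (const_ser u0 * (2 * c)) = (4 * \<kappa> * \<kappa> * b * c) * const_ser u0"
      by (simp add: mult_ac)
    ultimately show ?thesis unfolding kkbc by (simp add: graded_0_const_ser_iff)
  qed
  moreover have "Q = killing_comb H \<kappa> p u0 (fls_X * up) (fls_X * um)"
  proof (rule coeff_mat_eqI)
    fix n :: int
    have ql: "q * lam (-1) = const_ser y - const_ser z"
      unfolding q by (simp add: mult.commute[of _ "fls_shift 1 1"] lam_inverse)
    have half_twice: "half * (x + x) = (x :: 'm lser)" for x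
    proof -
      have "half * (x + x) = (half + half) * x" by (simp only: distrib_left distrib_right)
      then show ?thesis by (simp only: hh mult_1)
    qed
    consider "n = 0" | "n = 1" | "n = -1" | "n \<noteq> 0" "n * n \<noteq> 1"
      using zmult_eq_1_iff[of n n] by blast
    then show "coeff_mat n Q = coeff_mat n (killing_comb H \<kappa> p u0 (fls_X * up) (fls_X * um))"
    proof cases
      case 1
      then show ?thesis unfolding coeff_mat_killing_comb by (simp add: co u0)
    next
      case 2
      have "half * (s - of_int 1 * (q * lam (-1))) = half * (const_ser z + const_ser z)"
        unfolding ql s by (simp add: algebra_simps)
      then have "half * (s - of_int 1 * (q * lam (-1))) = const_ser z" by (simp only: half_twice)
      then show ?thesis
        unfolding 2 coeff_mat_killing_comb s_def[symmetric] q_def[symmetric] co z by simp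
    next
      case 3
      have "half * (s - of_int (-1) * (q * lam (-1))) = half * (const_ser y + const_ser y)"
        unfolding ql s by (simp add: algebra_simps)
      then have "half * (s - of_int (-1) * (q * lam (-1))) = const_ser y" by (simp only: half_twice)
      then show ?thesis
        unfolding 3 coeff_mat_killing_comb s_def[symmetric] q_def[symmetric] co y by simp
    next
      case 4
      then show ?thesis unfolding coeff_mat_killing_comb by (simp add: co)
    qed
  qed
  ultimately show ?thesis using that by blast
qed

end

theorem theorem4p4:
  fixes H :: "('m::{t2_space,second_countable_topology}, 'e::euclidean_space) cmc"
    and r \<kappa> :: "'m lser"
    and p :: "('m \<Rightarrow> complex) fps"
  assumes "truncated_cmc_hierarchy H"
    and "dressing H r \<kappa> p"
  shows "formal_killing H (P_plus H \<kappa> p) \<and> formal_killing H (P_minus H \<kappa> p) \<and>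
    {Q. formal_killing H Q \<and> cosh_sinh_form H Q} =
      {Q. (\<exists>u0 up um. Q = killing_comb H \<kappa> p u0 up um) \<and> cosh_sinh_form H Q} \<and>
    {Q. formal_killing H Q \<and> cosh_sinh_form H Q} =
      {killing_comb H \<kappa> p u0 (fls_X * up) (fls_X * um) | u0 up um.
         u0 \<in> even_power_series \<and> up \<in> even_power_series \<and> um \<in> even_power_series}"
proof -
  interpret dressed H r \<kappa> p using assms by unfold_locales
  \<comment> \<open>The converse inclusions follow from \<open>formal_killing_comb\<close> and
    \<open>cosh_sinh_form_killing_comb\<close>.\<close>
  have "\<exists>u0 up um. Q = killing_comb H \<kappa> p u0 (fls_X * up) (fls_X * um) \<and>
      u0 \<in> even_power_series \<and> up \<in> even_power_series \<and> um \<in> even_power_series"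
    if "formal_killing H Q" "cosh_sinh_form H Q" for Q
    using killing_comb_even_power_series[OF that] by metis
  then show ?thesis
    using formal_killing_P_plus formal_killing_P_minus formal_killing_comb cosh_sinh_form_killing_comb
    by (intro conjI set_eqI; simp only: mem_Collect_eq) blast+
qed

end
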